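(* Let $M$ be a real $2\times 2$ matrix and $u\in\mathbb{R}^2$ such that the iterated function system $\{T_m,T_p\}$, $T_m(v)=Mv-u$, $T_p(v)=Mv+u$, is non-degenerate, and let $A$ be its attractor. If every eigenvalue $\theta$ of $M$ satisfies $2^{-1/4}<|\theta|<1$, then $A$ has non-empty interior. More precisely: (1) if $0.832<\lambda<\mu<1$, then $A_{\lambda,\mu}$ has non-empty interior; (2) if $2^{-1/2}<\lambda<\mu<1$, then $A_{-\lambda,\mu}$ has non-empty interior; (3) if $0.832<\nu<1$, then $A_\nu$ has non-empty interior; (4) if $\kappa=a+bi\in\mathbb{C}\setminus\mathbb{R}$ and $2^{-1/4}<|\kappa|<1$, then $A_\kappa$ has non-empty interior.
   Context: For a real $2\times2$ matrix $M$ with both eigenvalues less than $1$ in modulus and a vector $u\ne 0$ in $\mathbb{R}^2$, put $T_m(v)=Mv-u$ and $T_p(v)=Mv+u$. The attractor of the iterated function system (IFS) $\{T_m,T_p\}$ is the unique non-empty compact set $A\subset\mathbb{R}^2$ with $A=T_m(A)\cup T_p(A)$. The IFS is called degenerate if it is restricted to a one-dimensional subspace of $\mathbb{R}^2$; this occurs if some eigenvalue of $M$ is $0$, or if $M$ is a scalar multiple of the identity. For a non-degenerate IFS, it is assumed that $u$ is a cyclic vector for $M$, i.e. the span of $\{M^nu: n\ge 0\}$ is $\mathbb{R}^2$. So "non-degenerate" means: $M$ is invertible and $u$ is cyclic for $M$. Particular attractors: - $A_{\lambda,\mu}$ (positive real case, $0<\lambda<\mu<1$): the attractor for $M=\begin{pmatrix}\lambda&0\\0&\mu\end{pmatrix}$,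 $u=\begin{pmatrix}1\\1\end{pmatrix}$. - $A_{-\lambda,\mu}$ (mixed real case, $0<\lambda,\mu<1$): the attractor for $M=\begin{pmatrix}-\lambda&0\\0&\mu\end{pmatrix}$, $u=\begin{pmatrix}1\\1\end{pmatrix}$. - $A_\nu$ (Jordan block case, $0<\nu<1$): the attractor for $M=\begin{pmatrix}\nu&1\\0&\nu\end{pmatrix}$, $u=\begin{pmatrix}0\\1\end{pmatrix}$. - $A_\kappa$ (complex case, $\kappa\in\mathbb{C}\setminus\mathbb{R}$, $|\kappa|<1$): identifying $\mathbb{R}^2$ with $\mathbb{C}$, the attractor of the maps $T_m(z)=\kappa z-1$, $T_p(z)=\kappa z+1$. *)

theory Defs
  imports "HOL-Analysis.Analysis"
begin

definition is_attractor :: "('a::topological_space \<Rightarrow> 'a) set \<Rightarrow> 'a set \<Rightarrow> bool" where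
  "is_attractor F A \<longleftrightarrow> compact A \<and> A \<noteq> {} \<and> A = (\<Union>T\<in>F. T ` A)"

(* Meaningful when exactly one such set exists, as for the affine systems below
   when all eigenvalues of the linear part have modulus < 1. *)
definition attractor :: "('a::topological_space \<Rightarrow> 'a) set \<Rightarrow> 'a set" where
  "attractor F = (THE A. is_attractor F A)"

definition T_m :: "real^2^2 \<Rightarrow> real^2 \<Rightarrow> real^2 \<Rightarrow> real^2" where
  "T_m M u v = M *v v - u"

definition T_p :: "real^2^2 \<Rightarrow> real^2 \<Rightarrow> real^2 \<Rightarrow> real^2" where
  "T_p M u v = M *v v + u"

definition affine_attractor :: "real^2^2 \<Rightarrow> real^2 \<Rightarrow> (real^2) set" where
  "affine_attractor M u = attractor {T_m M u, T_p M u}"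

definition cyclic_vector :: "real^2^2 \<Rightarrow> real^2 \<Rightarrow> bool" where
  "cyclic_vector M u \<longleftrightarrow> span (range (\<lambda>n. ((\<lambda>v. M *v v) ^^ n) u)) = UNIV"

definition nondegenerate :: "real^2^2 \<Rightarrow> real^2 \<Rightarrow> bool" where
  "nondegenerate M u \<longleftrightarrow> invertible M \<and> cyclic_vector M u"

(* Eigenvalues of a real matrix are taken over the complex numbers. *)
definition is_eigenvalue :: "real^2^2 \<Rightarrow> complex \<Rightarrow> bool" where
  "is_eigenvalue M \<theta> \<longleftrightarrow>
     (\<exists>w::complex^2. w \<noteq> 0 \<and> map_matrix complex_of_real M *v w = \<theta> *s w)"

(* Matrices are given by rows.  The set A_{-lam,\<mu>} of the mixed real case is
   A_real (- lam) \<mu>. *)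
definition A_real :: "real \<Rightarrow> real \<Rightarrow> (real^2) set" where
  "A_real lam \<mu> = affine_attractor (vector [vector [lam, 0], vector [0, \<mu>]]) (vector [1, 1])"

definition A_jordan :: "real \<Rightarrow> (real^2) set" where
  "A_jordan \<nu> = affine_attractor (vector [vector [\<nu>, 1], vector [0, \<nu>]]) (vector [0, 1])"

definition A_complex :: "complex \<Rightarrow> complex set" where
  "A_complex \<kappa> = attractor {\<lambda>z. \<kappa> * z - 1, \<lambda>z. \<kappa> * z + 1}"

end

theory Submission
  imports Defs
begin

text \<open>
The attractor of \<open>v \<mapsto> f v - u\<close>, \<open>v \<mapsto> f v + u\<close> contains every bounded set \<open>K\<close>
with \<open>K \<subseteq> (f K - u) \<union> (f K + u)\<close> (\<open>subinvariant_subset\<close>): a point of such a \<open>K\<close> can be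
expanded with digits \<open>\<plusminus>1\<close> for ever without leaving \<open>K\<close>. Two independent mechanisms produce
interior points.

The first handles the diagonal and the Jordan families. Suppose that
\<open>u = (\<Sum>j=1..n. c\<^sub>j f\<^sup>j u)\<close> with \<open>\<Sum>\<bar>c\<^sub>j\<bar> \<le> 2\<close>. Among all sums \<open>\<Sum>s\<^sub>j f\<^sup>j u\<close>, the coefficient
\<open>s\<^sub>0 \<in> [-2, 2]\<close> can be replaced by the nearer of the digits \<open>1\<close> and \<open>-1\<close>; the error has modulus
at most 1, and the relation moves it to the higher iterates, where \<open>\<bar>c\<^sub>j\<bar>\<close> bounds what it adds.
Suitable bounds on the \<open>s\<^sub>j\<close> therefore define a zonotope \<open>K\<close> as above, and \<open>K\<close> has interior
points when \<open>u\<close> and \<open>f u\<close> are independent (\<open>interior_if_short_relation\<close>). The three families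
come down to real polynomials \<open>1 - a x - b x\<^sup>n\<close> that vanish at the eigenvalues, doubly for a
Jordan block, and have \<open>\<bar>a\<bar> + \<bar>b\<bar> \<le> 2\<close>. In the mixed case \<open>n = 2\<close> gives the bound
\<open>1/\<surd>2\<close>. For positive eigenvalues, \<open>n = 8\<close> gives a length of at most
\<open>8/(7 x) + 1/(7 x\<^sup>8)\<close>, where \<open>x\<close> is the smaller eigenvalue, and this is below 2 from 0.832 on.

The second is topological and covers all non-degenerate matrices with eigenvalues in the open
unit disc and \<open>(det M)\<^sup>2 > 1/2\<close>, hence the general claim and the complex family (\<open>interior_if_determinant_large\<close>). Let \<open>C\<close> be the
attractor for \<open>f \<circ> f\<close> and \<open>u\<close>. Grouping even and odd powers shows that the attractor for
\<open>f\<close> is \<open>C + f C\<close>. Since \<open>\<bar>det (f \<circ> f)\<bar> > 1/2\<close>, the two pieces of \<open>C\<close> cannot be disjoint,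
because they would have too much area together; so any two points of \<open>C\<close> are joined by paths
arbitrarily close to \<open>C\<close>. Now \<open>C\<close> contains two points that differ by \<open>2 u\<close>, so \<open>f C\<close> contains
two that differ by \<open>2 f u\<close>. Continuing nearby paths periodically along these two independent
vectors gives a continuous map of the plane at bounded distance from the identity, which is
onto by Brouwer's theorem. In the limit the translates of \<open>C + f C\<close> by the lattice spanned by
\<open>2 u\<close> and \<open>2 f u\<close> cover the plane, and by Baire's theorem \<open>C + f C\<close> has interior points.
\<close>

section \<open>Attractors of a pair of affine maps with a common linear part\<close>

text \<open>
Spectral radius below 1, in a form that involves neither eigenvalues nor an adapted norm: \<open>f\<close>
itself may expand some vectors.
\<close>

definition power_contracting :: "('a::real_normed_vector \<Rightarrow> 'a) \<Rightarrow> bool" where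
  "power_contracting f \<longleftrightarrow>
     (\<exists>C r. 0 \<le> C \<and> 0 \<le> r \<and> r < 1 \<and> (\<forall>k v. norm ((f ^^ k) v) \<le> C * r ^ k * norm v))"

definition pm_image :: "('a::real_vector \<Rightarrow> 'a) \<Rightarrow> 'a \<Rightarrow> 'a set \<Rightarrow> 'a set" where
  "pm_image f u S = (\<lambda>v. f v - u) ` S \<union> (\<lambda>v. f v + u) ` S"

definition pm_attractor :: "('a::real_normed_vector \<Rightarrow> 'a) \<Rightarrow> 'a \<Rightarrow> 'a set" where
  "pm_attractor f u = attractor {\<lambda>v. f v - u, \<lambda>v. f v + u}"

lemma is_attractor_pm:
  "is_attractor {\<lambda>v. f v - u, \<lambda>v. f v + u} A \<longleftrightarrow> compact A \<and> A \<noteq> {} \<and> A = pm_image f u A"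
  by (simp add: is_attractor_def pm_image_def)

lemma pm_image_mono: "S \<subseteq> T \<Longrightarrow> pm_image f u S \<subseteq> pm_image f u T"
  by (auto simp: pm_image_def)

lemma mem_pm_imageE:
  assumes "x \<in> pm_image f u S"
  obtains s y where "s = 1 \<or> s = (-1::real)" "y \<in> S" "x = f y + s *\<^sub>R u"
proof -
  from assms(1) have "\<exists>s. \<exists>y\<in>S. (s = 1 \<or> s = (-1::real)) \<and> x = f y + s *\<^sub>R u"
    unfolding pm_image_def
  proof (elim UnE imageE)
    fix v assume "x = f v - u" "v \<in> S"
    then show ?thesis by (intro exI[of _ "-1"] bexI[of _ v]) simp_all
  next
    fix v assume "x = f v + u" "v \<in> S"
    then show ?thesis by (intro exI[of _ 1] bexI[of _ v]) simp_all
  qed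
  then show ?thesis using that by blast
qed

lemma mem_pm_imageI:
  assumes "s = 1 \<or> s = (-1::real)" "y \<in> S"
  shows "f y + s *\<^sub>R u \<in> pm_image f u S"
  using assms unfolding pm_image_def by auto

lemma power_contracting_null:
  assumes "power_contracting f" "bounded S" "\<epsilon> > 0"
  obtains n where "\<forall>v\<in>S. norm ((f ^^ n) v) < \<epsilon>"
proof -
  from assms(1) obtain C r where C: "0 \<le> C" "0 \<le> r" "r < 1"
    and le: "\<And>k v. norm ((f ^^ k) v) \<le> C * r ^ k * norm v"
    unfolding power_contracting_def by blast
  from assms(2) obtain B where B: "B > 0" "\<And>v. v \<in> S \<Longrightarrow> norm v \<le> B"
    using bounded_pos by blast
  have "(\<lambda>k. C * r ^ k * B) \<longlonglongrightarrow> C * 0 * B"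
    using C by (intro tendsto_intros LIMSEQ_power_zero) auto
  then have "\<forall>\<^sub>F k in sequentially. C * r ^ k * B < \<epsilon>"
    using assms(3) by (auto dest: order_tendstoD(2))
  then obtain n where n: "C * r ^ n * B < \<epsilon>"
    by (auto simp: eventually_sequentially)
  have "norm ((f ^^ n) v) < \<epsilon>" if "v \<in> S" for v
  proof -
    have "norm ((f ^^ n) v) \<le> C * r ^ n * norm v" by (rule le)
    also have "\<dots> \<le> C * r ^ n * B" using B(2)[OF that] C by (intro mult_left_mono) auto
    finally show ?thesis using n by simp
  qed
  then show ?thesis using that by blast
qed

text \<open>
Follow the digits of \<open>x\<close> for \<open>n\<close> steps inside \<open>K\<close>, and apply the same digits to a point of \<open>A\<close>:
the digits cancel in the difference.
\<close>

lemma pm_image_iterate_close: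
  fixes f :: "'a::real_normed_vector \<Rightarrow> 'a"
  assumes lin: "linear f" and K: "K \<subseteq> pm_image f u K"
    and A: "pm_image f u A \<subseteq> A" "A \<noteq> {}" and "x \<in> K"
  shows "\<exists>y\<in>A. \<exists>k\<in>K. \<exists>a\<in>A. x - y = (f ^^ n) (k - a)"
  using \<open>x \<in> K\<close>
proof (induction n arbitrary: x)
  case 0
  then show ?case using A(2) by auto
next
  case (Suc n)
  from K Suc.prems obtain s x' where x': "s = 1 \<or> s = (-1::real)" "x' \<in> K" "x = f x' + s *\<^sub>R u"
    by (blast elim: mem_pm_imageE)
  from Suc.IH[OF x'(2)] obtain y k a
    where y: "y \<in> A" "k \<in> K" "a \<in> A" "x' - y = (f ^^ n) (k - a)" by blast
  have "f y + s *\<^sub>R u \<in> A"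
    using mem_pm_imageI[OF x'(1) y(1)] A(1) by blast
  moreover have "x - (f y + s *\<^sub>R u) = (f ^^ Suc n) (k - a)"
    using y(4) by (simp add: x'(3) linear_diff[OF lin, symmetric])
  ultimately show ?case using y by blast
qed

text \<open>
The common source of uniqueness (two attractors are subinvariant sets for one another) and of
all interior points constructed below.
\<close>

lemma subinvariant_subset:
  fixes f :: "'a::real_normed_vector \<Rightarrow> 'a"
  assumes lin: "linear f" and contr: "power_contracting f"
    and K: "bounded K" "K \<subseteq> pm_image f u K"
    and A: "compact A" "A \<noteq> {}" "pm_image f u A \<subseteq> A"
  shows "K \<subseteq> A"
proof
  fix x assume x: "x \<in> K"
  have "\<exists>y\<in>A. dist y x < \<epsilon>" if eps: "\<epsilon> > 0" for \<epsilon>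
  proof -
    have bd: "bounded {k - a | k a. k \<in> K \<and> a \<in> A}"
      using bounded_differences[OF K(1) compact_imp_bounded[OF A(1)]]
      by (rule bounded_subset) blast
    obtain n where n: "\<forall>v\<in>{k - a | k a. k \<in> K \<and> a \<in> A}. norm ((f ^^ n) v) < \<epsilon>"
      by (rule power_contracting_null[OF contr bd eps])
    from pm_image_iterate_close[OF lin K(2) A(3,2) x, of n]
    obtain y k a where "y \<in> A" "k \<in> K" "a \<in> A" "x - y = (f ^^ n) (k - a)" by blast
    moreover from this(2,3) have "norm ((f ^^ n) (k - a)) < \<epsilon>" using n by blast
    ultimately show ?thesis by (metis dist_commute dist_norm)
  qed
  then have "x \<in> closure A"
    by (simp add: closure_approachable)
  then show "x \<in> A"
    using compact_imp_closed[OF A(1)] by simp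
qed

text \<open>
Expanding \<open>x \<in> K\<close> for \<open>n\<close> steps leaves a geometric sum plus \<open>f\<^sup>n k\<close> with \<open>k \<in> K\<close>, and the latter
tends to 0. The resulting radius depends on \<open>f\<close> and \<open>u\<close> only, so that the union of all
bounded subinvariant sets is bounded.
\<close>

lemma pm_image_bounded_bound:
  fixes f :: "'a::euclidean_space \<Rightarrow> 'a"
  assumes lin: "linear f" and contr: "power_contracting f"
  obtains R where "\<And>K. bounded K \<Longrightarrow> K \<subseteq> pm_image f u K \<Longrightarrow> K \<subseteq> cball 0 R"
proof -
  from contr obtain C r where C: "0 \<le> C" "0 \<le> r" "r < 1"
    and le: "\<And>k v. norm ((f ^^ k) v) \<le> C * r ^ k * norm v"
    unfolding power_contracting_def by blast
  have fn: "linear (f ^^ n)" for n 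
    using lin by (induction n) (simp_all add: linear_id linear_compose)
  have partial: "\<exists>k\<in>K. norm (x - (f ^^ n) k) \<le> (\<Sum>i<n. C * r ^ i * norm u)"
    if K: "K \<subseteq> pm_image f u K" and "x \<in> K" for K x n
  proof (induction n)
    case 0
    then show ?case using \<open>x \<in> K\<close> by auto
  next
    case (Suc n)
    then obtain k where k: "k \<in> K" "norm (x - (f ^^ n) k) \<le> (\<Sum>i<n. C * r ^ i * norm u)" by blast
    from K k(1) obtain s k' where k': "s = 1 \<or> s = (-1::real)" "k' \<in> K" "k = f k' + s *\<^sub>R u"
      by (blast elim: mem_pm_imageE)
    have "x - (f ^^ Suc n) k' = (x - (f ^^ n) k) + s *\<^sub>R (f ^^ n) u"
      by (simp add: k'(3) linear_add[OF fn] linear_scale[OF fn] funpow_swap1)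
    then have "norm (x - (f ^^ Suc n) k') \<le> norm (x - (f ^^ n) k) + norm (s *\<^sub>R (f ^^ n) u)"
      by (simp only: norm_triangle_ineq)
    also have "norm (s *\<^sub>R (f ^^ n) u) = norm ((f ^^ n) u)" using k'(1) by auto
    finally have "norm (x - (f ^^ Suc n) k') \<le> (\<Sum>i<Suc n. C * r ^ i * norm u)"
      using k(2) le[of n u] by simp
    then show ?case using k'(2) by blast
  qed
  have geo: "(\<Sum>i<n. C * r ^ i * norm u) \<le> C * norm u / (1 - r)" for n
  proof -
    have "(\<Sum>i<n. r ^ i) \<le> 1 / (1 - r)"
      using C by (simp add: sum_gp_strict divide_right_mono)
    from mult_left_mono[OF this, of "C * norm u"] show ?thesis
      using C by (simp add: sum_distrib_left mult_ac)
  qed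
  show ?thesis
  proof (rule that[of "C * norm u / (1 - r) + 1"], rule subsetI)
    fix K x assume K: "bounded K" "K \<subseteq> pm_image f u K" and x: "x \<in> K"
    obtain n where n: "\<forall>v\<in>K. norm ((f ^^ n) v) < 1"
      using power_contracting_null[OF contr K(1), of 1] by auto
    obtain k where k: "k \<in> K" "norm (x - (f ^^ n) k) \<le> (\<Sum>i<n. C * r ^ i * norm u)"
      using partial[OF K(2) x] by blast
    have "norm x \<le> norm (x - (f ^^ n) k) + norm ((f ^^ n) k)"
      by (metis diff_add_cancel norm_triangle_ineq)
    then have "norm x \<le> C * norm u / (1 - r) + 1"
      using k(2) n[rule_format, OF k(1)] geo[of n] by linarith
    then show "x \<in> cball 0 (C * norm u / (1 - r) + 1)" by simp
  qed
qed

text \<open>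
A fixed point is a non-empty subinvariant set, which makes the attractor non-empty. It exists
because \<open>1 - f\<close> is injective: a fixed vector of \<open>f\<close> contradicts the decay of the powers.
\<close>

lemma pm_fixpoint:
  fixes f :: "'a::euclidean_space \<Rightarrow> 'a"
  assumes lin: "linear f" and contr: "power_contracting f"
  obtains x where "f x + u = x"
proof -
  have lg: "linear (\<lambda>x. x - f x)" using lin
    by (intro linear_compose_sub linear_ident)
  have "inj (\<lambda>x. x - f x)"
  proof (rule ccontr)
    assume "\<not> inj (\<lambda>x. x - f x)"
    then obtain v where v: "v \<noteq> 0" "f v = v"
      unfolding linear_injective_0[OF lg] by (metis eq_iff_diff_eq_0)
    have "(f ^^ n) v = v" for n by (induction n) (auto simp: v)
    moreover obtain n where "norm ((f ^^ n) v) < norm v"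
      using power_contracting_null[OF contr, of "{v}" "norm v"] v by auto
    ultimately show False by simp
  qed
  then have "surj (\<lambda>x. x - f x)"
    using linear_injective_imp_surjective[OF lg] by simp
  then obtain x where "x - f x = u" by (metis surjD)
  then have "f x + u = x" by (metis add.commute diff_add_cancel)
  then show ?thesis using that by blast
qed

lemma compact_pm_image:
  fixes f :: "'a::euclidean_space \<Rightarrow> 'a"
  assumes "linear f" "compact S"
  shows "compact (pm_image f u S)"
proof -
  have "continuous_on S f"
    using assms(1) by (simp add: linear_continuous_on linear_conv_bounded_linear)
  then show ?thesis
    unfolding pm_image_def using assms(2)
    by (intro compact_Un compact_continuous_image continuous_intros)
qed

text \<open>
The attractor is the largest bounded subinvariant set: its image and its closure are again
bounded and subinvariant, hence contained in it.
\<close>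

lemma pm_attractor_exists:
  fixes f :: "'a::euclidean_space \<Rightarrow> 'a"
  assumes lin: "linear f" and contr: "power_contracting f"
  shows "\<exists>A. is_attractor {\<lambda>v. f v - u, \<lambda>v. f v + u} A"
proof -
  define A where "A = \<Union>{K. bounded K \<and> K \<subseteq> pm_image f u K}"
  obtain R where R: "\<And>K. bounded K \<Longrightarrow> K \<subseteq> pm_image f u K \<Longrightarrow> K \<subseteq> cball 0 R"
    using pm_image_bounded_bound[OF lin contr] by blast
  have bd: "bounded A"
    using R unfolding A_def by (intro bounded_subset[OF bounded_cball[of 0 R]]) blast
  have sub: "A \<subseteq> pm_image f u A"
    unfolding A_def pm_image_def by blast
  have max: "K \<subseteq> A" if "bounded K" "K \<subseteq> pm_image f u K" for K
    using that unfolding A_def by blast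
  have comp: "compact (closure A)" using bd by simp
  have "closure A \<subseteq> pm_image f u (closure A)"
    using sub pm_image_mono[OF closure_subset] compact_imp_closed[OF compact_pm_image[OF lin comp]]
    by (intro closure_minimal) blast+
  then have "closure A \<subseteq> A"
    using comp by (intro max compact_imp_bounded)
  then have cA: "compact A"
    using comp closure_subset by (metis subset_antisym)
  have "pm_image f u A \<subseteq> A"
    by (intro max compact_imp_bounded compact_pm_image lin cA pm_image_mono sub)
  moreover obtain x where "f x + u = x" using pm_fixpoint[OF lin contr] .
  then have "{x} \<subseteq> A" by (intro max) (auto simp: pm_image_def)
  ultimately show ?thesis
    using cA sub by (auto simp: is_attractor_pm)
qed

lemma pm_attractor_unique:
  fixes f :: "'a::euclidean_space \<Rightarrow> 'a"
  assumes lin: "linear f" and contr: "power_contracting f"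
    and A: "is_attractor {\<lambda>v. f v - u, \<lambda>v. f v + u} A"
  shows "pm_attractor f u = A"
proof -
  have sub: "B \<subseteq> B'"
    if "is_attractor {\<lambda>v. f v - u, \<lambda>v. f v + u} B" "is_attractor {\<lambda>v. f v - u, \<lambda>v. f v + u} B'"
    for B B'
    using that unfolding is_attractor_pm
    by (intro subinvariant_subset[OF lin contr, of B u B']) (auto intro: compact_imp_bounded)
  have "B = A" if "is_attractor {\<lambda>v. f v - u, \<lambda>v. f v + u} B" for B
    using sub[OF A that] sub[OF that A] by (rule equalityI[rotated])
  then show ?thesis
    unfolding pm_attractor_def attractor_def using A by (intro the_equality)
qed

lemma pm_attractor:
  fixes f :: "'a::euclidean_space \<Rightarrow> 'a"
  assumes lin: "linear f" and contr: "power_contracting f"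
  shows compact_pm_attractor: "compact (pm_attractor f u)"
    and pm_attractor_nonempty: "pm_attractor f u \<noteq> {}"
    and pm_attractor_fixed: "pm_image f u (pm_attractor f u) = pm_attractor f u"
proof -
  obtain A where A: "is_attractor {\<lambda>v. f v - u, \<lambda>v. f v + u} A"
    using pm_attractor_exists[OF lin contr] by blast
  then have *: "pm_attractor f u = A" by (rule pm_attractor_unique[OF lin contr])
  from A show "compact (pm_attractor f u)" "pm_attractor f u \<noteq> {}"
    "pm_image f u (pm_attractor f u) = pm_attractor f u"
    unfolding * is_attractor_pm by auto
qed

section \<open>Short linear relations among the iterates of a vector\<close>

text \<open>
\<open>\<alpha>\<close> and \<open>\<beta>\<close> are the coordinate functionals of the basis \<open>v, w\<close>; their existence says that
\<open>v, w\<close> is a basis, and therefore forces dimension 2.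
\<close>

definition coordinates_for ::
    "'a::real_vector \<Rightarrow> 'a \<Rightarrow> ('a \<Rightarrow> real) \<Rightarrow> ('a \<Rightarrow> real) \<Rightarrow> bool" where
  "coordinates_for v w \<alpha> \<beta> \<longleftrightarrow> linear \<alpha> \<and> linear \<beta> \<and> (\<forall>x. x = \<alpha> x *\<^sub>R v + \<beta> x *\<^sub>R w)
     \<and> \<alpha> v = 1 \<and> \<beta> v = 0 \<and> \<alpha> w = 0 \<and> \<beta> w = 1"

lemma coordinates_exist:
  fixes v w :: "real^2"
  assumes D: "v $ 1 * w $ 2 - v $ 2 * w $ 1 \<noteq> 0"
  shows "\<exists>\<alpha> \<beta>. coordinates_for v w \<alpha> \<beta>"
proof -
  define d where "d = v $ 1 * w $ 2 - v $ 2 * w $ 1"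
  have d: "d \<noteq> 0" using D by (simp add: d_def)
  let ?\<alpha> = "\<lambda>x::real^2. (x $ 1 * w $ 2 - x $ 2 * w $ 1) / d"
  let ?\<beta> = "\<lambda>x::real^2. (v $ 1 * x $ 2 - v $ 2 * x $ 1) / d"
  have "linear ?\<alpha>" "linear ?\<beta>"
    by (auto intro!: linearI simp: algebra_simps diff_divide_distrib add_divide_distrib)
  moreover have "x = ?\<alpha> x *\<^sub>R v + ?\<beta> x *\<^sub>R w" for x
  proof -
    have "(x $ 1 * w $ 2 - x $ 2 * w $ 1) *\<^sub>R v + (v $ 1 * x $ 2 - v $ 2 * x $ 1) *\<^sub>R w = d *\<^sub>R x"
      by (simp add: vec_eq_iff forall_2 d_def algebra_simps)
    then have "x = (1 / d) *\<^sub>R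
        ((x $ 1 * w $ 2 - x $ 2 * w $ 1) *\<^sub>R v + (v $ 1 * x $ 2 - v $ 2 * x $ 1) *\<^sub>R w)"
      using d by simp
    then show ?thesis by (simp add: scaleR_add_right)
  qed
  moreover have "?\<alpha> v = 1" "?\<beta> v = 0" "?\<alpha> w = 0" "?\<beta> w = 1"
    using d by (simp_all add: d_def)
  ultimately show ?thesis
    unfolding coordinates_for_def by blast
qed

text \<open>
The bounds \<open>m j\<close> are the tails of \<open>\<Sum>\<bar>c\<^sub>j\<bar>\<close>, so that \<open>\<bar>c\<^sub>j\<^sub>+\<^sub>1\<bar> + m (j + 1) = m j\<close>: this is the
room needed when an error of modulus at most 1 is moved from \<open>u\<close> to \<open>f\<^sup>j\<^sup>+\<^sup>1 u\<close> by the relation.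
The hypothesis \<open>\<Sum>\<bar>c\<^sub>j\<bar> \<le> 2\<close> says that \<open>m 0 \<le> 2\<close>, and this keeps the error at most 1.
\<close>

lemma interior_if_short_relation:
  fixes f :: "'a::euclidean_space \<Rightarrow> 'a"
  assumes lin: "linear f" and contr: "power_contracting f"
    and coords: "coordinates_for u (f u) \<alpha> \<beta>"
    and n: "2 \<le> n" "c n \<noteq> 0"
    and rel: "u = (\<Sum>j=1..n. c j *\<^sub>R (f ^^ j) u)"
    and short: "(\<Sum>j=1..n. \<bar>c j\<bar>) \<le> 2"
  shows "interior (pm_attractor f u) \<noteq> {}"
proof -
  have expand: "x = \<alpha> x *\<^sub>R u + \<beta> x *\<^sub>R f u" for x
    using coords by (simp only: coordinates_for_def)
  define m where "m j = (\<Sum>i\<in>{j<..n}. \<bar>c i\<bar>)" for j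
  define K where "K = {\<Sum>j<n. s j *\<^sub>R (f ^^ j) u | s. \<forall>j. \<bar>s j\<bar> \<le> m j}"
  have m_step: "m j = \<bar>c (Suc j)\<bar> + m (Suc j)" if "j < n" for j
  proof -
    have "{j<..n} = insert (Suc j) {Suc j<..n}" using that by auto
    then show ?thesis unfolding m_def by simp
  qed
  have m0: "m 0 \<le> 2"
    using short unfolding m_def by (simp add: atLeastSucAtMost_greaterThanAtMost[symmetric])
  have m_top: "m j = 0" if "n \<le> j" for j
    using that by (simp add: m_def)
  have m_pos: "0 < m j" if "j < n" for j
    unfolding m_def using that n by (intro sum_pos2[of _ n]) auto
  have "K \<subseteq> pm_image f u K"
  proof
    fix x assume "x \<in> K"
    then obtain s where s: "\<And>j. \<bar>s j\<bar> \<le> m j" and x: "x = (\<Sum>j<n. s j *\<^sub>R (f ^^ j) u)"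
      unfolding K_def by blast
    define a where "a = (if 0 \<le> s 0 then 1 else - 1 :: real)"
    have a: "a = 1 \<or> a = -1" "\<bar>s 0 - a\<bar> \<le> 1"
      using s[of 0] m0 by (auto simp: a_def)
    \<comment> \<open>the coefficients of \<open>x - a u\<close> after the error \<open>s 0 - a\<close> has been redistributed and one \<open>f\<close> removed\<close>
    define s' where "s' j = (if j < n then (s 0 - a) * c (Suc j) + s (Suc j) else 0)" for j
    have s': "\<bar>s' j\<bar> \<le> m j" for j
    proof (cases "j < n")
      case True
      have "\<bar>s' j\<bar> \<le> \<bar>s 0 - a\<bar> * \<bar>c (Suc j)\<bar> + \<bar>s (Suc j)\<bar>"
        using True abs_triangle_ineq[of "(s 0 - a) * c (Suc j)" "s (Suc j)"]
        by (simp add: s'_def abs_mult)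
      also have "\<dots> \<le> 1 * \<bar>c (Suc j)\<bar> + m (Suc j)"
        by (intro add_mono mult_right_mono a s) auto
      finally show ?thesis using m_step[OF True] by simp
    next
      case False
      then show ?thesis by (simp add: s'_def m_top)
    qed
    have rel': "(\<Sum>j<n. c (Suc j) *\<^sub>R (f ^^ Suc j) u) = u"
      using rel by (simp only: One_nat_def sum.atLeast1_atMost_eq)
    have "s n = 0" using s[of n] m_top[of n] by simp
    then have shift: "x = s 0 *\<^sub>R u + (\<Sum>j<n. s (Suc j) *\<^sub>R (f ^^ Suc j) u)"
      using sum.lessThan_Suc_shift[of "\<lambda>j. s j *\<^sub>R (f ^^ j) u" n] by (simp add: x)
    have "f (\<Sum>j<n. s' j *\<^sub>R (f ^^ j) u) = (\<Sum>j<n. s' j *\<^sub>R (f ^^ Suc j) u)"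
      by (simp add: linear_sum[OF lin] linear_scale[OF lin])
    also have "\<dots> = (\<Sum>j<n. (s 0 - a) *\<^sub>R c (Suc j) *\<^sub>R (f ^^ Suc j) u + s (Suc j) *\<^sub>R (f ^^ Suc j) u)"
      by (intro sum.cong refl) (simp add: s'_def scaleR_add_left)
    also have "\<dots> = (s 0 - a) *\<^sub>R u + (\<Sum>j<n. s (Suc j) *\<^sub>R (f ^^ Suc j) u)"
      by (simp only: sum.distrib scaleR_right.sum[symmetric] rel')
    finally have "x = f (\<Sum>j<n. s' j *\<^sub>R (f ^^ j) u) + a *\<^sub>R u"
      using shift by (simp add: algebra_simps)
    moreover have "(\<Sum>j<n. s' j *\<^sub>R (f ^^ j) u) \<in> K"
      unfolding K_def using s' by blast
    ultimately show "x \<in> pm_image f u K"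
      using mem_pm_imageI[OF a(1)] by simp
  qed
  moreover have "bounded K"
  proof (rule boundedI)
    fix x assume "x \<in> K"
    then obtain s where s: "\<And>j. \<bar>s j\<bar> \<le> m j" and x: "x = (\<Sum>j<n. s j *\<^sub>R (f ^^ j) u)"
      unfolding K_def by blast
    show "norm x \<le> (\<Sum>j<n. m j * norm ((f ^^ j) u))"
      unfolding x by (intro sum_norm_le) (simp add: mult_right_mono s)
  qed
  ultimately have "K \<subseteq> pm_attractor f u"
    by (rule subinvariant_subset[OF lin contr _ _ compact_pm_attractor[OF lin contr]
        pm_attractor_nonempty[OF lin contr] eq_refl[OF pm_attractor_fixed[OF lin contr]], rotated])
  moreover have "{x. \<bar>\<alpha> x\<bar> < m 0 \<and> \<bar>\<beta> x\<bar> < m 1} \<subseteq> K"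
  proof
    fix x assume x: "x \<in> {x. \<bar>\<alpha> x\<bar> < m 0 \<and> \<bar>\<beta> x\<bar> < m 1}"
    \<comment> \<open>points near 0 need the coefficients of \<open>u\<close> and \<open>f u\<close> only\<close>
    define s where "s j = (if j = 0 then \<alpha> x else if j = 1 then \<beta> x else 0)" for j :: nat
    obtain k where k: "n = Suc (Suc k)" using n(1) by (metis add_2_eq_Suc le_Suc_ex)
    have "m j \<ge> 0" for j by (simp add: m_def sum_nonneg)
    then have "\<forall>j. \<bar>s j\<bar> \<le> m j" using x by (auto simp: s_def less_imp_le)
    moreover have "(\<Sum>j<n. s j *\<^sub>R (f ^^ j) u) = \<alpha> x *\<^sub>R u + \<beta> x *\<^sub>R f u"
      unfolding k by (simp only: sum.lessThan_Suc_shift) (simp add: s_def)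
    then have "(\<Sum>j<n. s j *\<^sub>R (f ^^ j) u) = x"
      by (simp only: expand[symmetric])
    ultimately show "x \<in> K" unfolding K_def by blast
  qed
  moreover have "open {x. \<bar>\<alpha> x\<bar> < m 0 \<and> \<bar>\<beta> x\<bar> < m 1}"
    using coords unfolding coordinates_for_def
    by (intro open_Collect_conj open_Collect_less continuous_intros linear_continuous_on)
       (auto simp: linear_conv_bounded_linear)
  moreover have "0 \<in> {x. \<bar>\<alpha> x\<bar> < m 0 \<and> \<bar>\<beta> x\<bar> < m 1}"
    using coords m_pos n(1) unfolding coordinates_for_def by (simp add: linear_0)
  ultimately show ?thesis
    using interiorI[of "{x. \<bar>\<alpha> x\<bar> < m 0 \<and> \<bar>\<beta> x\<bar> < m 1}" 0 "pm_attractor f u"] by blast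
qed

lemma interior_if_trinomial_relation:
  fixes f :: "'a::euclidean_space \<Rightarrow> 'a"
  assumes lin: "linear f" and contr: "power_contracting f"
    and coords: "coordinates_for u (f u) \<alpha> \<beta>"
    and n: "2 \<le> n" "b \<noteq> 0"
    and rel: "u = a *\<^sub>R f u + b *\<^sub>R (f ^^ n) u"
    and short: "\<bar>a\<bar> + \<bar>b\<bar> \<le> 2"
  shows "interior (pm_attractor f u) \<noteq> {}"
proof -
  define c where "c j = (if j = 1 then a else if j = n then b else 0)" for j
  have sum: "(\<Sum>j=1..n. g j) = g 1 + g n" if "\<And>j. j \<noteq> 1 \<Longrightarrow> j \<noteq> n \<Longrightarrow> g j = 0"
    for g :: "nat \<Rightarrow> 'b::comm_monoid_add"
  proof -
    have "(\<Sum>j=1..n. g j) = (\<Sum>j\<in>{1,n}. g j)"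
      using n that by (intro sum.mono_neutral_right) auto
    then show ?thesis using n by auto
  qed
  show ?thesis
  proof (rule interior_if_short_relation[OF lin contr coords n(1), of c])
    show "c n \<noteq> 0" using n by (simp add: c_def)
    show "u = (\<Sum>j=1..n. c j *\<^sub>R (f ^^ j) u)"
      by (subst sum) (use n rel in \<open>simp_all add: c_def\<close>)
    show "(\<Sum>j=1..n. \<bar>c j\<bar>) \<le> 2"
      by (subst sum) (use n short in \<open>simp_all add: c_def\<close>)
  qed
qed

section \<open>Sums of two plane sets that stay close to paths\<close>

text \<open>
A solution of \<open>x + h x = z\<close> is a fixed point of \<open>x \<mapsto> z - h x\<close>, which maps the ball of radius \<open>B\<close>
about \<open>z\<close> to itself.
\<close>

lemma surj_bounded_perturbation:
  fixes h :: "'a::euclidean_space \<Rightarrow> 'a"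
  assumes cont: "continuous_on UNIV h" and bd: "\<And>x. norm (h x) \<le> B"
  shows "\<exists>x. x + h x = z"
proof -
  have "0 \<le> B" using bd[of z] norm_ge_zero order_trans by blast
  moreover have "continuous_on (cball z B) (\<lambda>x. z - h x)"
    using cont by (intro continuous_intros) (rule continuous_on_subset, auto)
  moreover have "(\<lambda>x. z - h x) \<in> cball z B \<rightarrow> cball z B"
    using bd by (simp add: dist_norm)
  ultimately obtain x where "z - h x = x"
    by (metis brouwer cball_eq_empty compact_cball convex_cball not_less)
  then have "x + h x = z" by (simp add: algebra_simps)
  then show ?thesis ..
qed

text \<open>
Laying translates of a path end to end along multiples of its displacement \<open>v\<close>.
\<close>

lemma continuous_quasiperiodic_extension:
  fixes g :: "real \<Rightarrow> 'a::real_normed_vector"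
  assumes cont: "continuous_on {0..1} g" and step: "g 1 = g 0 + v"
  shows "continuous_on UNIV (\<lambda>s. g (frac s) + of_int \<lfloor>s\<rfloor> *\<^sub>R v)"
proof -
  let ?G = "\<lambda>s. g (frac s) + of_int \<lfloor>s\<rfloor> *\<^sub>R v"
  have piece: "continuous_on {real_of_int n..real_of_int n + 1} ?G" for n
  proof -
    have "?G s = g (s - real_of_int n) + of_int n *\<^sub>R v"
      if "s \<in> {real_of_int n..real_of_int n + 1}" for s
    proof (cases "s = real_of_int n + 1")
      case True
      then have "frac s = 0" "\<lfloor>s\<rfloor> = n + 1" by (simp_all add: frac_def)
      then show ?thesis using True by (simp add: step algebra_simps)
    next
      case False
      then have "\<lfloor>s\<rfloor> = n" using that by (intro floor_unique) auto
      then show ?thesis by (simp add: frac_def)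
    qed
    moreover have "continuous_on {real_of_int n..real_of_int n + 1}
        (\<lambda>s. g (s - real_of_int n) + of_int n *\<^sub>R v)"
      by (intro continuous_intros continuous_on_compose2[OF cont]) auto
    ultimately show ?thesis by (metis (no_types, lifting) continuous_on_eq)
  qed
  have "isCont ?G s" for s
  proof -
    define n where "n = \<lfloor>s\<rfloor>"
    have n: "real_of_int n \<le> s" "s < real_of_int n + 1" unfolding n_def by linarith+
    have "continuous_on ({real_of_int (n - 1)..real_of_int (n - 1) + 1}
        \<union> {real_of_int n..real_of_int n + 1}) ?G"
      by (intro continuous_on_closed_Un piece) auto
    then have "continuous_on {real_of_int n - 1<..<real_of_int n + 1} ?G"
      by (rule continuous_on_subset) auto
    then show ?thesis
      using n by (simp add: continuous_on_eq_continuous_at)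
  qed
  then show ?thesis by (simp add: continuous_at_imp_continuous_on)
qed

text \<open>
A weakening of "\<open>p\<close> and \<open>p'\<close> are joined by a path in \<open>C\<close>" that can be proved for a compact
connected \<open>C\<close> without any local connectedness, and that suffices for compact sets, where the
limit \<open>\<epsilon> \<rightarrow> 0\<close> can be taken afterwards.
\<close>

definition joined_nearby :: "'a::metric_space set \<Rightarrow> 'a \<Rightarrow> 'a \<Rightarrow> bool" where
  "joined_nearby C p p' \<longleftrightarrow> (\<forall>\<epsilon>>0. \<exists>g. path g \<and> pathstart g = p \<and> pathfinish g = p'
     \<and> (\<forall>t\<in>{0..1}. \<exists>c\<in>C. dist (g t) c < \<epsilon>))"

text \<open>
Let \<open>G\<close> and \<open>H\<close> be the quasi-periodic extensions of paths near \<open>C\<close> and near \<open>D\<close>. The map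
\<open>x \<mapsto> G (\<alpha> x) + H (\<beta> x)\<close> differs from \<open>x = \<alpha> x v + \<beta> x w\<close> by a bounded amount, so it is onto;
and each of its values is a point near \<open>C + D\<close> shifted by a lattice vector.
\<close>

lemma sum_lattice_dense:
  fixes v w :: "'a::euclidean_space"
  assumes coords: "coordinates_for v w \<alpha> \<beta>"
    and C: "joined_nearby C p (p + v)" and D: "joined_nearby D q (q + w)" and eps: "\<epsilon> > 0"
  shows "\<exists>c\<in>C. \<exists>d\<in>D. \<exists>m n :: int. dist ((c + d) + (of_int m *\<^sub>R v + of_int n *\<^sub>R w)) z < \<epsilon>"
proof -
  have lin: "linear \<alpha>" "linear \<beta>" and expand: "x = \<alpha> x *\<^sub>R v + \<beta> x *\<^sub>R w" for x
    using coords by (simp_all only: coordinates_for_def)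
  have "\<epsilon> / 2 > 0" using eps by simp
  with C D obtain g h where g: "path g" "g 0 = p" "g 1 = p + v" "\<forall>t\<in>{0..1}. \<exists>c\<in>C. dist (g t) c < \<epsilon> / 2"
    and h: "path h" "h 0 = q" "h 1 = q + w" "\<forall>t\<in>{0..1}. \<exists>c\<in>D. dist (h t) c < \<epsilon> / 2"
    unfolding joined_nearby_def pathstart_def pathfinish_def by metis
  define G where "G s = g (frac s) + of_int \<lfloor>s\<rfloor> *\<^sub>R v" for s
  define H where "H s = h (frac s) + of_int \<lfloor>s\<rfloor> *\<^sub>R w" for s
  define P where "P x = (G (\<alpha> x) - \<alpha> x *\<^sub>R v) + (H (\<beta> x) - \<beta> x *\<^sub>R w)" for x
  have contG: "continuous_on UNIV G" and contH: "continuous_on UNIV H"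
    unfolding G_def H_def using g h
    by (auto intro!: continuous_quasiperiodic_extension simp: path_def)
  have contl: "continuous_on UNIV \<alpha>" "continuous_on UNIV \<beta>"
    using lin by (simp_all add: linear_continuous_on linear_conv_bounded_linear)
  have contP: "continuous_on UNIV P"
    unfolding P_def
    by (intro continuous_intros contl continuous_on_compose2[OF contG] continuous_on_compose2[OF contH]) auto
  have "bounded ((\<lambda>t. g t - t *\<^sub>R v) ` {0..1})" "bounded ((\<lambda>t. h t - t *\<^sub>R w) ` {0..1})"
    using g(1) h(1) unfolding path_def
    by (auto intro!: compact_imp_bounded compact_continuous_image continuous_intros)
  then obtain B1 B2 where B: "\<forall>t\<in>{0..1}. norm (g t - t *\<^sub>R v) \<le> B1" "\<forall>t\<in>{0..1}. norm (h t - t *\<^sub>R w) \<le> B2"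
    unfolding bounded_iff by auto
  have frac01: "frac s \<in> {0..1}" for s :: real
    using frac_lt_1[of s] by (simp add: less_imp_le)
  have "norm (P x) \<le> B1 + B2" for x
  proof -
    have "G s - s *\<^sub>R v = g (frac s) - frac s *\<^sub>R v" "H s - s *\<^sub>R w = h (frac s) - frac s *\<^sub>R w" for s
      by (simp_all add: G_def H_def frac_def algebra_simps)
    then have "P x = (g (frac (\<alpha> x)) - frac (\<alpha> x) *\<^sub>R v) + (h (frac (\<beta> x)) - frac (\<beta> x) *\<^sub>R w)"
      by (simp add: P_def)
    also have "norm \<dots> \<le> B1 + B2"
      using B frac01 by (intro norm_triangle_mono) blast+
    finally show ?thesis .
  qed
  then obtain x where "x + P x = z"
    using surj_bounded_perturbation[OF contP] by blast
  moreover have "x + P x = G (\<alpha> x) + H (\<beta> x)"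
    unfolding P_def by (subst (1) expand[of x]) simp
  ultimately have "z = G (\<alpha> x) + H (\<beta> x)" by simp
  then have z: "z = g (frac (\<alpha> x)) + h (frac (\<beta> x)) + (of_int \<lfloor>\<alpha> x\<rfloor> *\<^sub>R v + of_int \<lfloor>\<beta> x\<rfloor> *\<^sub>R w)"
    by (simp add: G_def H_def add_ac)
  obtain c d where c: "c \<in> C" "dist (g (frac (\<alpha> x))) c < \<epsilon> / 2" and d: "d \<in> D" "dist (h (frac (\<beta> x))) d < \<epsilon> / 2"
    using g(4) h(4) frac01 by meson
  have "dist (c + d + (of_int \<lfloor>\<alpha> x\<rfloor> *\<^sub>R v + of_int \<lfloor>\<beta> x\<rfloor> *\<^sub>R w)) z = dist (c + d) (g (frac (\<alpha> x)) + h (frac (\<beta> x)))"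
    unfolding z by simp
  also have "\<dots> \<le> dist c (g (frac (\<alpha> x))) + dist d (h (frac (\<beta> x)))"
    by (rule dist_triangle_add)
  also have "\<dots> < \<epsilon>" using c d by (simp add: dist_commute)
  finally show ?thesis using c d by blast
qed

text \<open>
The lattice translates of the compact set \<open>C + D\<close> form a closed dense set, i.e. the plane is
a countable union of copies of \<open>C + D\<close>, and these cannot all be nowhere dense.
\<close>

theorem interior_sum_of_joined_sets:
  fixes v w :: "'a::euclidean_space"
  assumes coords: "coordinates_for v w \<alpha> \<beta>"
    and C: "compact C" "joined_nearby C p (p + v)" and D: "compact D" "joined_nearby D q (q + w)"
  shows "interior (\<Union>c\<in>C. \<Union>d\<in>D. {c + d}) \<noteq> {}"
proof
  assume empty: "interior (\<Union>c\<in>C. \<Union>d\<in>D. {c + d}) = {}"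
  define S where "S = (\<Union>c\<in>C. \<Union>d\<in>D. {c + d})"
  define L where "L = {of_int m *\<^sub>R v + of_int n *\<^sub>R w | m n :: int. True}"
  have lin: "linear \<alpha>" "linear \<beta>" and dual: "\<alpha> v = 1" "\<beta> v = 0" "\<alpha> w = 0" "\<beta> w = 1"
    and expand: "x = \<alpha> x *\<^sub>R v + \<beta> x *\<^sub>R w" for x
    using coords by (simp_all only: coordinates_for_def)
  have compS: "compact S" unfolding S_def by (rule compact_sums'[OF C(1) D(1)])
  \<comment> \<open>the lattice is closed, being cut out by integrality of two continuous functionals\<close>
  have "L = (\<alpha> -` \<int>) \<inter> (\<beta> -` \<int>)"
  proof
    show "L \<subseteq> (\<alpha> -` \<int>) \<inter> (\<beta> -` \<int>)"
      by (auto simp: L_def linear_add lin linear_scale dual)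
    show "(\<alpha> -` \<int>) \<inter> (\<beta> -` \<int>) \<subseteq> L"
    proof
      fix x assume "x \<in> (\<alpha> -` \<int>) \<inter> (\<beta> -` \<int>)"
      then obtain m n :: int where "\<alpha> x = of_int m" "\<beta> x = of_int n"
        by (auto elim!: Ints_cases)
      then show "x \<in> L" using expand[of x] unfolding L_def by auto
    qed
  qed
  moreover have "closed ((\<alpha> -` \<int>) \<inter> (\<beta> -` \<int>))"
    using lin by (intro closed_Int closed_vimage closed_Ints linear_continuous_on)
      (simp_all add: linear_conv_bounded_linear)
  ultimately have closedL: "closed L" by simp
  have "L = (\<lambda>(m, n). of_int m *\<^sub>R v + of_int n *\<^sub>R w) ` (UNIV :: (int \<times> int) set)"
    by (auto simp: L_def)
  then have countL: "countable L" by simp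
  have "closed (\<Union>x\<in>S. \<Union>l\<in>L. {x + l})"
    by (rule compact_closed_sums[OF compS closedL])
  moreover have "z \<in> closure (\<Union>x\<in>S. \<Union>l\<in>L. {x + l})" for z
    unfolding closure_approachable
  proof (intro allI impI)
    fix \<epsilon> :: real assume "\<epsilon> > 0"
    from sum_lattice_dense[OF coords C(2) D(2) this, of z]
    show "\<exists>y\<in>(\<Union>x\<in>S. \<Union>l\<in>L. {x + l}). dist y z < \<epsilon>"
      unfolding S_def L_def by blast
  qed
  ultimately have cover: "(\<Union>x\<in>S. \<Union>l\<in>L. {x + l}) = UNIV"
    using closure_closed by blast
  let ?\<G> = "(\<lambda>l. - ((\<lambda>x. l + x) ` S)) ` L"
  have "UNIV \<subseteq> closure (\<Inter>?\<G>)"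
  proof (rule Baire)
    show "countable ?\<G>" using countL by simp
    fix T assume "T \<in> ?\<G>"
    then obtain l where T: "T = - ((\<lambda>x. l + x) ` S)" by blast
    have "closed ((\<lambda>x. l + x) ` S)"
      using compS by (simp add: closed_translation compact_imp_closed)
    moreover have "interior ((\<lambda>x. l + x) ` S) = {}"
      using empty by (simp add: interior_translation S_def)
    ultimately show "openin (top_of_set UNIV) T \<and> UNIV \<subseteq> closure T"
      unfolding T by (simp add: closure_complement open_Compl)
  qed simp
  moreover have "\<Inter>?\<G> = {}"
  proof -
    have "\<exists>l\<in>L. z \<in> (\<lambda>x. l + x) ` S" for z
    proof -
      from cover obtain x l where "x \<in> S" "l \<in> L" "z = x + l" by blast
      then show ?thesis by (metis add.commute image_eqI)
    qed
    then show ?thesis by blast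
  qed
  ultimately show False by simp
qed

section \<open>Linear maps with large determinant\<close>

text \<open>
If the two images of \<open>C\<close> were disjoint, so would be those of a small neighbourhood \<open>N\<close> of \<open>C\<close>
that is mapped into itself. They have total measure \<open>2 \<bar>det g\<bar>\<close> times the measure of \<open>N\<close>,
which is more than \<open>N\<close> can hold. As \<open>g\<close> need not be a contraction, a metric neighbourhood need
not be mapped into itself; \<open>N = C + D\<close> uses the \<open>g\<close>-invariant neighbourhood \<open>D\<close> of 0 of points
whose whole orbit stays small.
\<close>

lemma attractor_halves_meet:
  fixes g :: "real^'n::{finite,wellorder} \<Rightarrow> real^'n::_" and u :: "real^'n::_"
  assumes lin: "linear g" and contr: "power_contracting g" and det: "1 / 2 < \<bar>det (matrix g)\<bar>"
  defines "C \<equiv> pm_attractor g u"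
  shows "(\<lambda>v. g v - u) ` C \<inter> (\<lambda>v. g v + u) ` C \<noteq> {}"
proof
  assume disj: "(\<lambda>v. g v - u) ` C \<inter> (\<lambda>v. g v + u) ` C = {}"
  have compC: "compact C" and neC: "C \<noteq> {}" and fixC: "pm_image g u C = C"
    unfolding C_def by (rule compact_pm_attractor pm_attractor_nonempty pm_attractor_fixed; fact)+
  have contg: "continuous_on S g" for S
    using lin by (simp add: linear_conv_bounded_linear linear_continuous_on)
  have contgn: "continuous_on S (g ^^ n)" for n S
  proof (induction n)
    case (Suc n)
    show ?case unfolding funpow.simps by (rule continuous_on_compose[OF Suc contg])
  qed (simp add: id_def)
  have "continuous_on C g" by (rule contg)
  then have "compact ((\<lambda>v. g v - u) ` C)" "compact ((\<lambda>v. g v + u) ` C)"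
    by (auto intro!: compact_continuous_image continuous_on_add continuous_on_diff compC)
  then obtain d where d: "d > 0" "\<And>x y. x \<in> C \<Longrightarrow> y \<in> C \<Longrightarrow> d \<le> dist (g x - u) (g y + u)"
    using separate_compact_closed[OF _ compact_imp_closed disj] by (metis image_eqI)
  from contr obtain M r where M: "0 \<le> M" "0 \<le> r" "r < 1"
    and le: "\<And>k v. norm ((g ^^ k) v) \<le> M * r ^ k * norm v"
    unfolding power_contracting_def by blast
  define D where "D = {y. \<forall>n. norm ((g ^^ n) y) \<le> d / 3}"
  have gD: "g y \<in> D" if "y \<in> D" for y
    unfolding D_def
  proof (intro CollectI allI)
    fix n
    have "norm ((g ^^ Suc n) y) \<le> d / 3" using that unfolding D_def by blast
    then show "norm ((g ^^ n) (g y)) \<le> d / 3" by (simp add: funpow_swap1)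
  qed
  have D_small: "norm y \<le> d / 3" if "y \<in> D" for y
    using that unfolding D_def by (auto dest: spec[of _ 0])
  have "closed D"
    unfolding D_def by (intro closed_Collect_all closed_Collect_le continuous_intros contgn)
  then have compD: "compact D"
    using D_small unfolding compact_eq_bounded_closed bounded_iff by blast
  have D_nhd: "ball 0 (d / 3 / (M + 1)) \<subseteq> D"
  proof
    fix y :: "real^'n::_" assume "y \<in> ball 0 (d / 3 / (M + 1))"
    then have y: "(M + 1) * norm y \<le> d / 3"
      using M by (simp add: field_simps)
    have "norm ((g ^^ n) y) \<le> d / 3" for n
    proof -
      have "M * r ^ n * norm y \<le> (M + 1) * norm y"
        using M power_le_one[of r n] mult_left_mono[of "r ^ n" 1 M] by (intro mult_right_mono) auto
      then show ?thesis using le[of n y] y by linarith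
    qed
    then show "y \<in> D" by (simp add: D_def)
  qed
  define N where "N = (\<Union>x\<in>C. \<Union>y\<in>D. {x + y})"
  have N_I: "x + y \<in> N" if "x \<in> C" "y \<in> D" for x y using that by (auto simp: N_def)
  have compN: "compact N" unfolding N_def by (rule compact_sums'[OF compC compD])
  then have measN: "N \<in> lmeasurable" by (rule lmeasurable_compact)
  let ?m = "\<lambda>v. v - u" and ?p = "\<lambda>v. v + u"
  have image_meas: "?m ` g ` N \<in> lmeasurable" "?p ` g ` N \<in> lmeasurable"
    "measure lebesgue (?m ` g ` N) = \<bar>det (matrix g)\<bar> * measure lebesgue N"
    "measure lebesgue (?p ` g ` N) = \<bar>det (matrix g)\<bar> * measure lebesgue N"
    using measurable_linear_image[OF lin measN] measure_linear_image[OF lin measN]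
    by (simp_all add: measurable_translation_subtract measure_translation_subtract
        measurable_translation measure_translation add.commute[of _ u] cong: image_cong_simp)
  have N_m: "g c + y - u \<in> N" "g c + y + u \<in> N" if "c \<in> C" "y \<in> D" for c y
  proof -
    have "g c - u \<in> C" "g c + u \<in> C" using fixC that(1) unfolding pm_image_def by blast+
    from N_I[OF this(1) that(2)] N_I[OF this(2) that(2)]
    show "g c + y - u \<in> N" "g c + y + u \<in> N" by (simp_all add: algebra_simps)
  qed
  have "?m ` g ` N \<union> ?p ` g ` N \<subseteq> N"
  proof -
    have "g x - u \<in> N" "g x + u \<in> N" if "x \<in> N" for x
    proof -
      from that obtain c y where "c \<in> C" "y \<in> D" "x = c + y" unfolding N_def by blast
      then show "g x - u \<in> N" "g x + u \<in> N"
        using N_m[of c "g y"] gD by (simp_all add: linear_add[OF lin])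
    qed
    then show ?thesis by blast
  qed
  then have "measure lebesgue (?m ` g ` N \<union> ?p ` g ` N) \<le> measure lebesgue N"
    using image_meas measN by (intro measure_mono_fmeasurable) (auto intro: fmeasurableD fmeasurable.Un)
  moreover have "?m ` g ` N \<inter> ?p ` g ` N = {}"
  proof -
    have False if "x \<in> N" "x' \<in> N" "g x - u = g x' + u" for x x'
    proof -
      from that(1,2) obtain c y c' y' where c: "c \<in> C" "y \<in> D" "x = c + y" "c' \<in> C" "y' \<in> D" "x' = c' + y'"
        unfolding N_def by blast
      have "(g c - u) - (g c' + u) = g y' - g y"
        using that(3) by (simp add: c linear_add[OF lin] algebra_simps)
      then have "dist (g c - u) (g c' + u) \<le> norm (g y') + norm (g y)"
        by (simp only: dist_norm norm_triangle_ineq4)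
      also have "\<dots> \<le> d / 3 + d / 3" using c gD D_small by (intro add_mono) auto
      \<comment> \<open>two thirds of the distance \<open>d\<close> between the images of \<open>C\<close> do not suffice to bridge it\<close>
      finally show False using d(1) d(2)[OF c(1,4)] by simp
    qed
    then show ?thesis by blast
  qed
  then have "measure lebesgue (?m ` g ` N \<union> ?p ` g ` N) = 2 * \<bar>det (matrix g)\<bar> * measure lebesgue N"
    using image_meas by (subst measure_Un3) simp_all
  moreover have "measure lebesgue N > 0"
  proof -
    obtain c where c: "c \<in> C" using neC by blast
    have "(+) c ` ball 0 (d / 3 / (M + 1)) \<subseteq> N"
      using D_nhd N_I[OF c] by blast
    moreover have "0 < d / 3 / (M + 1)" using d(1) M(1) by simp
    then have "\<not> negligible ((+) c ` ball 0 (d / 3 / (M + 1)))"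
      by (intro open_not_negligible open_translation open_ball) (simp del: divide_divide_eq_left)
    ultimately have "\<not> negligible N" using negligible_subset by blast
    then show ?thesis
      using measN by (simp add: negligible_iff_measure zero_less_measure_iff)
  qed
  ultimately show False
    using det by simp
qed

text \<open>
Start from a ball around \<open>C\<close> and apply the pair of maps \<open>n\<close> times. Each resulting set \<open>B n\<close>
is path-connected, because the two images of \<open>B n\<close> overlap where those of \<open>C\<close> do; and \<open>B n\<close>
lies between \<open>C\<close> and a neighbourhood of \<open>C\<close> that shrinks with \<open>n\<close>.
\<close>

lemma attractor_joined_nearby:
  fixes g :: "'a::euclidean_space \<Rightarrow> 'a" and u :: 'a
  assumes lin: "linear g" and contr: "power_contracting g"
  defines "C \<equiv> pm_attractor g u"
  assumes meet: "(\<lambda>v. g v - u) ` C \<inter> (\<lambda>v. g v + u) ` C \<noteq> {}" and p: "p \<in> C" "p' \<in> C"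
  shows "joined_nearby C p p'"
  unfolding joined_nearby_def
proof (intro allI impI)
  fix \<epsilon> :: real assume eps: "\<epsilon> > 0"
  have compC: "compact C" and neC: "C \<noteq> {}" and fixC: "pm_image g u C = C"
    unfolding C_def by (rule compact_pm_attractor pm_attractor_nonempty pm_attractor_fixed; fact)+
  obtain R where R: "C \<subseteq> ball 0 R"
    using bounded_subset_ballD[OF compact_imp_bounded[OF compC]] by blast
  have contg: "continuous_on S g" for S
    using lin by (simp add: linear_conv_bounded_linear linear_continuous_on)
  define B where "B n = (pm_image g u ^^ n) (ball 0 R)" for n
  have CB: "C \<subseteq> B n" for n
  proof (induction n)
    case 0
    then show ?case using R by (simp add: B_def)
  next
    case (Suc n)
    from pm_image_mono[OF this, of g u] show ?case by (simp add: fixC B_def)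
  qed
  have "path_connected (B n)" for n
  proof (induction n)
    case 0
    then show ?case by (simp add: B_def convex_imp_path_connected)
  next
    case (Suc n)
    have "(\<lambda>v. g v - u) ` B n \<inter> (\<lambda>v. g v + u) ` B n \<noteq> {}"
      using meet CB[of n] by blast
    then have "path_connected (pm_image g u (B n))"
      unfolding pm_image_def
      by (intro path_connected_Un path_connected_continuous_image Suc continuous_intros contg)
    then show ?case by (simp add: B_def)
  qed
  moreover
  have close: "\<exists>c\<in>C. \<exists>b\<in>ball 0 R. \<exists>a\<in>C. x - c = (g ^^ n) (b - a)" if "x \<in> B n" for n x
    using that
  proof (induction n arbitrary: x)
    case 0
    obtain c where "c \<in> C" using neC by blast
    then show ?case using 0 unfolding B_def
      by (intro bexI[of _ c] bexI[of _ x]) simp_all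
  next
    case (Suc n)
    then have "x \<in> pm_image g u (B n)" by (simp add: B_def)
    then obtain s y where s: "s = 1 \<or> s = (-1::real)" "y \<in> B n" "x = g y + s *\<^sub>R u"
      by (blast elim: mem_pm_imageE)
    from Suc.IH[OF s(2)] obtain c b a
      where *: "c \<in> C" "b \<in> ball 0 R" "a \<in> C" "y - c = (g ^^ n) (b - a)" by blast
    have "x - (g c + s *\<^sub>R u) = (g ^^ Suc n) (b - a)"
      using *(4) by (simp add: s(3) linear_diff[OF lin, symmetric])
    moreover have "g c + s *\<^sub>R u \<in> C"
      using mem_pm_imageI[OF s(1) *(1)] fixC by blast
    ultimately show ?case using * by blast
  qed
  have bd: "bounded (\<Union>b\<in>ball 0 R. \<Union>a\<in>C. {b - a})"
    by (intro bounded_differences bounded_ball compact_imp_bounded compC)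
  obtain n where n: "\<forall>v\<in>(\<Union>b\<in>ball 0 R. \<Union>a\<in>C. {b - a}). norm ((g ^^ n) v) < \<epsilon>"
    by (rule power_contracting_null[OF contr bd eps])
  ultimately obtain h where h: "path h" "path_image h \<subseteq> B n" "pathstart h = p" "pathfinish h = p'"
    using p CB[of n] unfolding path_connected_def by blast
  have "\<exists>c\<in>C. dist (h t) c < \<epsilon>" if "t \<in> {0..1}" for t
  proof -
    have "h t \<in> B n" using h(2) that by (auto simp: path_image_def)
    from close[OF this] obtain c b a
      where *: "c \<in> C" "b \<in> ball 0 R" "a \<in> C" "h t - c = (g ^^ n) (b - a)" by blast
    then have "norm ((g ^^ n) (b - a)) < \<epsilon>" using n by blast
    then show ?thesis using * by (metis dist_norm)
  qed
  then show "\<exists>h. path h \<and> pathstart h = p \<and> pathfinish h = p' \<and> (\<forall>t\<in>{0..1}. \<exists>c\<in>C. dist (h t) c < \<epsilon>)"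
    using h by blast
qed

lemma joined_nearby_linear_image:
  fixes f :: "'a::euclidean_space \<Rightarrow> 'b::euclidean_space"
  assumes lin: "linear f" and C: "joined_nearby C p p'"
  shows "joined_nearby (f ` C) (f p) (f p')"
  unfolding joined_nearby_def
proof (intro allI impI)
  fix \<epsilon> :: real assume eps: "\<epsilon> > 0"
  obtain B where B: "B > 0" "\<And>x. norm (f x) \<le> B * norm x"
    using linear_bounded_pos[OF lin] by blast
  then have "\<epsilon> / B > 0" using eps by simp
  with C obtain g where g: "path g" "pathstart g = p" "pathfinish g = p'"
      "\<forall>t\<in>{0..1}. \<exists>c\<in>C. dist (g t) c < \<epsilon> / B"
    unfolding joined_nearby_def by metis
  have "\<exists>c\<in>f ` C. dist ((f \<circ> g) t) c < \<epsilon>" if t: "t \<in> {0..1}" for t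
  proof -
    obtain c where c: "c \<in> C" "dist (g t) c < \<epsilon> / B" using g(4) t by blast
    have "dist (f (g t)) (f c) \<le> B * dist (g t) c"
      using B(2)[of "g t - c"] by (simp add: dist_norm linear_diff[OF lin])
    also have "\<dots> < \<epsilon>" using c(2) B(1) by (simp add: field_simps)
    finally show ?thesis using c(1) by auto
  qed
  moreover have "path (f \<circ> g)"
    using g(1) lin by (intro path_continuous_image)
      (simp_all add: linear_conv_bounded_linear linear_continuous_on)
  ultimately show "\<exists>h. path h \<and> pathstart h = f p \<and> pathfinish h = f p'
      \<and> (\<forall>t\<in>{0..1}. \<exists>c\<in>f ` C. dist (h t) c < \<epsilon>)"
    using g(2,3) by (intro exI[of _ "f \<circ> g"]) (simp add: pathstart_compose pathfinish_compose)
qed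

lemma power_contracting_square:
  assumes "power_contracting f"
  shows "power_contracting (f \<circ> f)"
proof -
  from assms obtain C r where C: "0 \<le> C" "0 \<le> r" "r < 1"
    and le: "\<And>k v. norm ((f ^^ k) v) \<le> C * r ^ k * norm v"
    unfolding power_contracting_def by blast
  have "(f \<circ> f) ^^ k = f ^^ (2 * k)" for k
    by (induction k) (simp_all add: fun_eq_iff)
  then have *: "norm (((f \<circ> f) ^^ k) v) \<le> C * (r\<^sup>2) ^ k * norm v" for k v
    using le[of "2 * k" v] by (simp only: power_mult)
  have "r\<^sup>2 < 1" using C by (simp add: power_less_one_iff)
  then show ?thesis
    unfolding power_contracting_def using C(1) * zero_le_power2[of r] by blast
qed

text \<open>
In terms of digit expansions: the even and the odd powers of \<open>f\<close> in \<open>\<Sum>\<plusminus>f\<^sup>k u\<close> form two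
independent expansions in powers of \<open>f \<circ> f\<close>.
\<close>

lemma attractor_split_square:
  fixes f :: "'a::euclidean_space \<Rightarrow> 'a"
  assumes lin: "linear f" and contr: "power_contracting f"
  shows "pm_attractor f u =
    (\<Union>c\<in>pm_attractor (f \<circ> f) u. \<Union>d\<in>f ` pm_attractor (f \<circ> f) u. {c + d})"
proof -
  define C where "C = pm_attractor (f \<circ> f) u"
  have lin2: "linear (f \<circ> f)" using lin by (rule linear_compose[OF lin])
  note contr2 = power_contracting_square[OF contr]
  have compC: "compact C" and neC: "C \<noteq> {}" and fixC: "pm_image (f \<circ> f) u C = C"
    unfolding C_def
    by (rule compact_pm_attractor[OF lin2 contr2] pm_attractor_nonempty[OF lin2 contr2]
        pm_attractor_fixed[OF lin2 contr2])+
  have compfC: "compact (f ` C)"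
    using lin by (intro compact_continuous_image compC)
      (simp add: linear_conv_bounded_linear linear_continuous_on)
  let ?S = "\<Union>c\<in>C. \<Union>d\<in>f ` C. {c + d}"
  have "pm_image f u ?S = (\<Union>c\<in>pm_image (f \<circ> f) u C. \<Union>d\<in>f ` C. {c + d})"
  proof (intro equalityI subsetI)
    fix x assume "x \<in> pm_image f u ?S"
    then obtain s y where s: "s = 1 \<or> s = (-1::real)" "y \<in> ?S" "x = f y + s *\<^sub>R u"
      by (rule mem_pm_imageE)
    from s(2) obtain c d where c: "c \<in> C" "d \<in> C" "y = c + f d" by blast
    have "x = ((f \<circ> f) d + s *\<^sub>R u) + f c"
      by (simp add: s c linear_add[OF lin])
    then show "x \<in> (\<Union>c\<in>pm_image (f \<circ> f) u C. \<Union>d\<in>f ` C. {c + d})"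
      using mem_pm_imageI[OF s(1) c(2)] c(1) by blast
  next
    fix x assume "x \<in> (\<Union>c\<in>pm_image (f \<circ> f) u C. \<Union>d\<in>f ` C. {c + d})"
    then obtain b c where c: "b \<in> pm_image (f \<circ> f) u C" "c \<in> C" "x = b + f c" by blast
    from c(1) obtain s d where s: "s = 1 \<or> s = (-1::real)" "d \<in> C" "b = (f \<circ> f) d + s *\<^sub>R u"
      by (rule mem_pm_imageE)
    have x: "x = f (c + f d) + s *\<^sub>R u"
      by (simp add: s c linear_add[OF lin])
    have "c + f d \<in> ?S" using c(2) s(2) by blast
    from mem_pm_imageI[OF s(1) this] show "x \<in> pm_image f u ?S"
      unfolding x .
  qed
  then have "pm_image f u ?S = ?S" by (simp only: fixC)
  moreover have "?S \<noteq> {}" using neC by blast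
  ultimately have "is_attractor {\<lambda>v. f v - u, \<lambda>v. f v + u} ?S"
    using compact_sums'[OF compC compfC] by (simp only: is_attractor_pm simp_thms)
  from pm_attractor_unique[OF lin contr this] show ?thesis by (simp only: C_def)
qed

text \<open>
\<open>(det f)\<^sup>2\<close> is the determinant of \<open>f \<circ> f\<close>, whose attractor \<open>C\<close> is the set that must not fall
apart. The vectors \<open>2 u\<close> and \<open>2 f u\<close> are the displacements required in \<open>C\<close> and \<open>f C\<close>.
\<close>

theorem interior_if_determinant_large:
  fixes f :: "real^'n::{finite,wellorder} \<Rightarrow> real^'n::_"
  assumes lin: "linear f" and contr: "power_contracting f"
    and coords: "coordinates_for u (f u) \<alpha> \<beta>" and det: "1 / 2 < (det (matrix f))\<^sup>2"
  shows "interior (pm_attractor f u) \<noteq> {}"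
proof -
  define C where "C = pm_attractor (f \<circ> f) u"
  have lin2: "linear (f \<circ> f)" using lin by (rule linear_compose[OF lin])
  note contr2 = power_contracting_square[OF contr]
  have compC: "compact C" and neC: "C \<noteq> {}" and fixC: "pm_image (f \<circ> f) u C = C"
    unfolding C_def
    by (rule compact_pm_attractor[OF lin2 contr2] pm_attractor_nonempty[OF lin2 contr2]
        pm_attractor_fixed[OF lin2 contr2])+
  have compfC: "compact (f ` C)"
    using lin by (intro compact_continuous_image compC)
      (simp add: linear_conv_bounded_linear linear_continuous_on)
  have "1 / 2 < \<bar>det (matrix (f \<circ> f))\<bar>"
    using det by (simp add: matrix_compose[OF lin lin] det_mul power2_eq_square)
  note meet = attractor_halves_meet[OF lin2 contr2 this, of u]
  obtain c where "c \<in> C" using neC by blast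
  define p where "p = f (f c) - u"
  \<comment> \<open>the images of \<open>c\<close> under the two maps differ by \<open>2 u\<close>\<close>
  have p: "p \<in> C" "p + 2 *\<^sub>R u \<in> C"
    using fixC \<open>c \<in> C\<close> unfolding pm_image_def p_def
    by (force simp: scaleR_2)+
  have joined: "joined_nearby C p (p + 2 *\<^sub>R u)"
    using attractor_joined_nearby[OF lin2 contr2 meet] p unfolding C_def by blast
  then have "joined_nearby (f ` C) (f p) (f p + 2 *\<^sub>R f u)"
    using joined_nearby_linear_image[OF lin joined]
    by (simp add: linear_add[OF lin] linear_scale[OF lin])
  moreover have "coordinates_for (2 *\<^sub>R u) (2 *\<^sub>R f u) (\<lambda>x. \<alpha> x / 2) (\<lambda>x. \<beta> x / 2)"
    using coords unfolding coordinates_for_def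
    by (auto simp: linear_scale linear_iff add_divide_distrib)
  ultimately show ?thesis
    unfolding attractor_split_square[OF lin contr] C_def[symmetric]
    using interior_sum_of_joined_sets compC compfC joined by blast
qed

section \<open>Two-by-two matrices\<close>

text \<open>
Each coordinate \<open>x\<^sub>k\<close> of \<open>f\<^sup>k v\<close> satisfies the linear recurrence with characteristic roots \<open>\<rho>, \<sigma>\<close>.
Splitting off one root leaves \<open>x\<^sub>k\<^sub>+\<^sub>1 = \<rho> x\<^sub>k + \<sigma>\<^sup>k y\<close> with a constant \<open>y\<close>. This form treats
distinct, equal and non-real roots alike; for equal roots \<open>x\<^sub>k\<close> may grow like \<open>k \<rho>\<^sup>k\<close>, which is
why the rate \<open>r\<close> is chosen strictly between the spectral radius and 1.
\<close>

lemma power_contracting_if_quadratic: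
  fixes f :: "'a::euclidean_space \<Rightarrow> 'a" and \<rho> \<sigma> :: complex
  assumes lin: "linear f"
    and quad: "\<And>v. f (f v) = t *\<^sub>R f v - d *\<^sub>R v"
    and roots: "complex_of_real t = \<rho> + \<sigma>" "complex_of_real d = \<rho> * \<sigma>"
    and small: "cmod \<rho> < 1" "cmod \<sigma> < 1"
  shows "power_contracting f"
proof -
  define R where "R = max (cmod \<rho>) (cmod \<sigma>)"
  define r where "r = (R + 1) / 2"
  have R: "0 \<le> R" "R < 1" "cmod \<rho> \<le> R" "cmod \<sigma> \<le> R"
    using small by (auto simp: R_def le_max_iff_disj)
  have r: "0 \<le> r" "R < r" "r < 1" using R by (auto simp: r_def)
  obtain B where B: "B > 0" "\<And>x. norm (f x) \<le> B * norm x"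
    using linear_bounded_pos[OF lin] by blast
  \<comment> \<open>just large enough for the induction step \<open>R C + (B + 1) \<le> r C\<close> and the start \<open>1 \<le> C\<close>\<close>
  define C where "C = (B + 1) / (r - R) + 1"
  have "(r - R) * C = (B + 1) + (r - R)"
    unfolding C_def distrib_left using r by simp
  then have "R * C + (B + 1) \<le> C * r"
    using r by (simp add: left_diff_distrib mult.commute[of C])
  moreover have "C \<ge> 1"
    using r B(1) by (simp add: C_def divide_nonneg_pos)
  ultimately have C: "R * C + (B + 1) \<le> C * r" "C \<ge> 1" by blast+
  have bound: "\<bar>(f ^^ k) v \<bullet> b\<bar> \<le> C * r ^ k * norm v" if b: "b \<in> Basis" for k v b
  proof -
    define x where "x k = complex_of_real ((f ^^ k) v \<bullet> b)" for k
    have rec: "x (Suc (Suc k)) = (\<rho> + \<sigma>) * x (Suc k) - (\<rho> * \<sigma>) * x k" for k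
      unfolding x_def roots(1,2)[symmetric]
      by (simp add: quad inner_diff_left)
    have y: "x (Suc k) - \<rho> * x k = \<sigma> ^ k * (x 1 - \<rho> * x 0)" for k
    proof (induction k)
      case (Suc k)
      have "x (Suc (Suc k)) - \<rho> * x (Suc k) = \<sigma> * (x (Suc k) - \<rho> * x k)"
        by (simp add: rec algebra_simps)
      then show ?case by (simp add: Suc.IH)
    qed simp
    have x0: "cmod (x 0) \<le> norm v" and x1: "cmod (x 1) \<le> B * norm v"
      using Basis_le_norm[OF b, of v] Basis_le_norm[OF b, of "f v"] B(2)[of v]
      by (simp_all add: x_def)
    have "cmod (x 1 - \<rho> * x 0) \<le> cmod (x 1) + cmod \<rho> * cmod (x 0)"
      by (metis norm_mult norm_triangle_ineq4)
    also have "\<dots> \<le> B * norm v + 1 * norm v"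
      using small by (intro add_mono mult_mono x0 x1) auto
    finally have y0: "cmod (x 1 - \<rho> * x 0) \<le> (B + 1) * norm v"
      by (simp add: algebra_simps)
    have "cmod (x k) \<le> C * r ^ k * norm v"
    proof (induction k)
      case 0
      then show ?case using x0 C(2) mult_right_mono[of 1 C "norm v"] by simp
    next
      case (Suc k)
      have "x (Suc k) = \<rho> * x k + \<sigma> ^ k * (x 1 - \<rho> * x 0)"
        using y[of k] by (simp add: algebra_simps)
      then have "cmod (x (Suc k)) \<le> cmod \<rho> * cmod (x k) + cmod \<sigma> ^ k * cmod (x 1 - \<rho> * x 0)"
        by (metis norm_mult norm_power norm_triangle_ineq)
      also have "\<dots> \<le> R * (C * r ^ k * norm v) + r ^ k * ((B + 1) * norm v)"
        using R r Suc y0 by (intro add_mono mult_mono power_mono) auto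
      also have "\<dots> = (R * C + (B + 1)) * (r ^ k * norm v)"
        by (simp add: algebra_simps)
      also have "\<dots> \<le> (C * r) * (r ^ k * norm v)"
        using C(1) r by (intro mult_right_mono) auto
      finally show ?case by (simp add: algebra_simps)
    qed
    then show ?thesis by (simp add: x_def)
  qed
  have "norm ((f ^^ k) v) \<le> (real DIM('a) * C) * r ^ k * norm v" for k v
  proof -
    have "norm ((f ^^ k) v) \<le> (\<Sum>b\<in>Basis. \<bar>(f ^^ k) v \<bullet> b\<bar>)" by (rule norm_le_l1)
    also have "\<dots> \<le> (\<Sum>b\<in>(Basis :: 'a set). C * r ^ k * norm v)"
      by (intro sum_mono bound)
    finally show ?thesis by (simp add: mult.assoc)
  qed
  moreover have "0 \<le> real DIM('a) * C" using C(2) by simp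
  ultimately show ?thesis
    unfolding power_contracting_def using r by blast
qed

text \<open>
The Cayley--Hamilton theorem in dimension 2.
\<close>

lemma matrix_square_2:
  fixes M :: "real^2^2"
  shows "M *v (M *v v) = (M $ 1 $ 1 + M $ 2 $ 2) *\<^sub>R (M *v v) - det M *\<^sub>R v"
  by (simp add: vec_eq_iff forall_2 matrix_vector_mult_def sum_2 det_2 algebra_simps)

lemma power_contracting_matrix_2:
  fixes M :: "real^2^2"
  assumes "complex_of_real (M $ 1 $ 1 + M $ 2 $ 2) = \<rho> + \<sigma>" "complex_of_real (det M) = \<rho> * \<sigma>"
    and "cmod \<rho> < 1" "cmod \<sigma> < 1"
  shows "power_contracting ((*v) M)"
  by (rule power_contracting_if_quadratic[OF matrix_vector_mul_linear matrix_square_2 assms])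

text \<open>
Both \<open>(M\<^sub>1\<^sub>2, \<theta> - M\<^sub>1\<^sub>1)\<close> and \<open>(\<theta> - M\<^sub>2\<^sub>2, M\<^sub>2\<^sub>1)\<close>, the columns of the adjugate of \<open>\<theta> - M\<close>, are
eigenvectors unless they vanish. A diagonal matrix has the standard basis vectors instead.
\<close>

lemma is_eigenvalue_if_root:
  fixes M :: "real^2^2"
  assumes root: "\<theta>\<^sup>2 - complex_of_real (M $ 1 $ 1 + M $ 2 $ 2) * \<theta> + complex_of_real (det M) = 0"
  shows "is_eigenvalue M \<theta>"
proof -
  have eigen: "is_eigenvalue M \<theta>"
    if "x \<noteq> 0 \<or> y \<noteq> 0" "M $ 1 $ 1 * x + M $ 1 $ 2 * y = \<theta> * x" "M $ 2 $ 1 * x + M $ 2 $ 2 * y = \<theta> * y" for x y :: complex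
    unfolding is_eigenvalue_def using that
    by (intro exI[of _ "vector [x, y]"])
       (auto simp: vec_eq_iff forall_2 map_matrix_def matrix_vector_mult_def sum_2)
  have char: "(\<theta> - M $ 1 $ 1) * (\<theta> - M $ 2 $ 2) = complex_of_real (M $ 1 $ 2) * M $ 2 $ 1"
    using root by (simp add: det_2 algebra_simps power2_eq_square)
  then have "M $ 1 $ 2 \<noteq> 0 \<or> M $ 2 $ 1 \<noteq> 0 \<or> \<theta> = M $ 1 $ 1 \<or> \<theta> = M $ 2 $ 2"
    by auto
  then consider "M $ 1 $ 2 \<noteq> 0" | "M $ 2 $ 1 \<noteq> 0"
    | "M $ 1 $ 2 = 0" "M $ 2 $ 1 = 0" "\<theta> = M $ 1 $ 1"
    | "M $ 1 $ 2 = 0" "M $ 2 $ 1 = 0" "\<theta> = M $ 2 $ 2"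
    by blast
  then show ?thesis
  proof cases
    case 1
    then show ?thesis
      using char by (intro eigen[of "M $ 1 $ 2" "\<theta> - M $ 1 $ 1"]) (auto simp: algebra_simps)
  next
    case 2
    then show ?thesis
      using char by (intro eigen[of "\<theta> - M $ 2 $ 2" "M $ 2 $ 1"]) (auto simp: algebra_simps)
  next
    case 3
    then show ?thesis by (intro eigen[of 1 0]) auto
  next
    case 4
    then show ?thesis by (intro eigen[of 0 1]) auto
  qed
qed

lemma eigenvalues_2:
  fixes M :: "real^2^2"
  obtains \<rho> \<sigma> where "is_eigenvalue M \<rho>" "is_eigenvalue M \<sigma>"
    "complex_of_real (M $ 1 $ 1 + M $ 2 $ 2) = \<rho> + \<sigma>" "complex_of_real (det M) = \<rho> * \<sigma>"
proof -
  define t d where "t = complex_of_real (M $ 1 $ 1 + M $ 2 $ 2)" and "d = complex_of_real (det M)"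
  define s where "s = csqrt (t\<^sup>2 - 4 * d)"
  have s: "s\<^sup>2 = t\<^sup>2 - 4 * d" by (simp add: s_def)
  have t: "t = (t + s) / 2 + (t - s) / 2" by (simp add: field_simps)
  have d: "d = (t + s) / 2 * ((t - s) / 2)"
    using s by (simp add: field_simps power2_eq_square)
  have root: "\<theta>\<^sup>2 - t * \<theta> + d = 0" if "\<theta> = (t + s) / 2 \<or> \<theta> = (t - s) / 2" for \<theta>
  proof -
    have "\<theta>\<^sup>2 - t * \<theta> + d = (\<theta> - (t + s) / 2) * (\<theta> - (t - s) / 2)"
      by (subst d, subst t) (simp add: algebra_simps power2_eq_square)
    then show ?thesis using that by auto
  qed
  show ?thesis
  proof (rule that[of "(t + s) / 2" "(t - s) / 2"])
    show "is_eigenvalue M ((t + s) / 2)" "is_eigenvalue M ((t - s) / 2)"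
      using root[of "(t + s) / 2"] root[of "(t - s) / 2"]
      by (auto intro!: is_eigenvalue_if_root simp: t_def d_def)
    show "complex_of_real (M $ 1 $ 1 + M $ 2 $ 2) = (t + s) / 2 + (t - s) / 2"
      using t by (simp add: t_def)
    show "complex_of_real (det M) = (t + s) / 2 * ((t - s) / 2)"
      using d by (simp add: d_def)
  qed
qed

lemma affine_attractor_eq: "affine_attractor M u = pm_attractor ((*v) M) u"
proof -
  have "T_m M u = (\<lambda>v. M *v v - u)" "T_p M u = (\<lambda>v. M *v v + u)"
    by (simp_all add: fun_eq_iff T_m_def T_p_def)
  then show ?thesis by (simp only: affine_attractor_def pm_attractor_def)
qed

lemma cyclic_vector_independent:
  assumes "cyclic_vector M u"
  shows "u $ 1 * (M *v u) $ 2 - u $ 2 * (M *v u) $ 1 \<noteq> 0"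
proof
  assume zero: "u $ 1 * (M *v u) $ 2 - u $ 2 * (M *v u) $ 1 = 0"
  let ?f = "\<lambda>v. M *v v"
  have span: "span (range (\<lambda>n. (?f ^^ n) u)) = UNIV"
    using assms by (simp add: cyclic_vector_def)
  have "\<exists>c. M *v u = c *\<^sub>R u"
  proof (cases "u = 0")
    case True
    then show ?thesis by simp
  next
    case False
    then consider "u $ 1 \<noteq> 0" | "u $ 2 \<noteq> 0" by (auto simp: vec_eq_iff forall_2)
    then show ?thesis
    proof cases
      case 1
      then show ?thesis using zero
        by (intro exI[of _ "(M *v u) $ 1 / u $ 1"]) (simp add: vec_eq_iff forall_2 field_simps)
    next
      case 2
      then show ?thesis using zero
        by (intro exI[of _ "(M *v u) $ 2 / u $ 2"]) (simp add: vec_eq_iff forall_2 field_simps)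
    qed
  qed
  then obtain c where c: "M *v u = c *\<^sub>R u" by blast
  have "(?f ^^ n) u \<in> span {u}" for n
  proof -
    have "(?f ^^ n) u = c ^ n *\<^sub>R u"
      by (induction n) (simp_all add: c matrix_vector_mult_scaleR)
    then show ?thesis by (simp add: span_scale span_base)
  qed
  then have "UNIV \<subseteq> span {u}"
    using span_minimal[of "range (\<lambda>n. (?f ^^ n) u)" "span {u}"] span by auto
  then have "dim (UNIV :: (real^2) set) \<le> dim {u}"
    by (metis dim_span dim_subset)
  also have "dim {u} \<le> card {u}" by (rule dim_le_card') simp
  finally show False by simp
qed

lemma two_powr_minus_quarter: "(2 powr (-1/4) :: real) ^ 4 = 1 / 2"
  by (simp add: powr_power)

lemma two_powr_minus_half: "(2 powr (-1/2) :: real)\<^sup>2 = 1 / 2"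
  by (simp add: powr_power)

text \<open>
The determinant is the product of the eigenvalues, so its square exceeds \<open>(2 powr (-1/4))\<^sup>4 = 1/2\<close>.
\<close>

lemma interior_nondegenerate:
  assumes nondeg: "nondegenerate M u"
    and eig: "\<And>\<theta>. is_eigenvalue M \<theta> \<Longrightarrow> 2 powr (-1/4) < cmod \<theta> \<and> cmod \<theta> < 1"
  shows "interior (affine_attractor M u) \<noteq> {}"
proof -
  obtain \<rho> \<sigma> where eigs: "is_eigenvalue M \<rho>" "is_eigenvalue M \<sigma>"
    and rel: "complex_of_real (M $ 1 $ 1 + M $ 2 $ 2) = \<rho> + \<sigma>" "complex_of_real (det M) = \<rho> * \<sigma>"
    by (rule eigenvalues_2)
  obtain \<alpha> \<beta> where coords: "coordinates_for u (M *v u) \<alpha> \<beta>"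
    using coordinates_exist[OF cyclic_vector_independent] nondeg unfolding nondegenerate_def by blast
  define q :: real where "q = 2 powr (-1/4)"
  have q: "0 < q" "q ^ 4 = 1 / 2" by (simp_all only: q_def two_powr_minus_quarter) simp
  have "q * q < cmod \<rho> * cmod \<sigma>"
    using eig[OF eigs(1)] eig[OF eigs(2)] q(1) by (intro mult_strict_mono) (auto simp: q_def)
  also have "cmod \<rho> * cmod \<sigma> = \<bar>det M\<bar>"
    by (simp only: norm_mult[symmetric] rel(2)[symmetric] norm_of_real)
  finally have "(q * q)\<^sup>2 < \<bar>det M\<bar>\<^sup>2"
    using q(1) by (intro power_strict_mono) auto
  then have "1 / 2 < (det (matrix ((*v) M)))\<^sup>2"
    using q(2) by (simp add: power2_eq_square power4_eq_xxxx mult.assoc)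
  then show ?thesis
    unfolding affine_attractor_eq
    using eig[OF eigs(1)] eig[OF eigs(2)]
    by (intro interior_if_determinant_large[OF matrix_vector_mul_linear _ coords]
        power_contracting_matrix_2[OF rel]) auto
qed

text \<open>
Attractors of semiconjugate systems correspond; this carries the plane of complex numbers over
to \<open>real^2\<close>, where determinants are available.
\<close>

lemma pm_attractor_linear_image:
  fixes f :: "'a::euclidean_space \<Rightarrow> 'a" and g :: "'b::euclidean_space \<Rightarrow> 'b"
  assumes f: "linear f" "power_contracting f" and g: "linear g" "power_contracting g"
    and h: "linear h" "\<And>v. h (f v) = g (h v)"
  shows "pm_attractor g (h u) = h ` pm_attractor f u"
proof (rule pm_attractor_unique[OF g])
  let ?A = "pm_attractor f u"
  have "pm_image g (h u) (h ` ?A) = h ` pm_image f u ?A"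
    by (simp add: pm_image_def image_Un image_image h linear_add linear_diff)
  then have "pm_image g (h u) (h ` ?A) = h ` ?A"
    by (simp only: pm_attractor_fixed[OF f])
  moreover have "compact (h ` ?A)"
    using compact_pm_attractor[OF f] h(1)
    by (intro compact_continuous_image) (simp_all add: linear_conv_bounded_linear linear_continuous_on)
  ultimately show "is_attractor {\<lambda>v. g v - h u, \<lambda>v. g v + h u} (h ` ?A)"
    using pm_attractor_nonempty[OF f] by (simp add: is_attractor_pm)
qed

text \<open>
Multiplication by \<open>\<kappa>\<close> has determinant \<open>\<bar>\<kappa>\<bar>\<^sup>2\<close>, and 1 and \<open>\<kappa>\<close> are independent over the reals
exactly because \<open>\<kappa>\<close> is not real.
\<close>

lemma interior_complex:
  assumes \<kappa>: "\<kappa> \<notin> \<real>" "2 powr (-1/4) < cmod \<kappa>" "cmod \<kappa> < 1"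
  shows "interior (A_complex \<kappa>) \<noteq> {}"
proof -
  define M :: "real^2^2" where "M = vector [vector [Re \<kappa>, - Im \<kappa>], vector [Im \<kappa>, Re \<kappa>]]"
  define h :: "complex \<Rightarrow> real^2" where "h z = vector [Re z, Im z]" for z
  have A: "A_complex \<kappa> = pm_attractor ((*) \<kappa>) 1"
    by (simp add: A_complex_def pm_attractor_def)
  have f: "linear ((*) \<kappa>)" "power_contracting ((*) \<kappa>)"
  proof -
    show "linear ((*) \<kappa>)" by (rule bounded_linear.linear[OF bounded_linear_mult_right])
    have "((*) \<kappa> ^^ k) v = \<kappa> ^ k * v" for k v by (induction k) simp_all
    then show "power_contracting ((*) \<kappa>)"
      unfolding power_contracting_def using \<kappa>(3)
      by (intro exI[of _ 1] exI[of _ "cmod \<kappa>"]) (simp add: norm_mult norm_power)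
  qed
  have detM: "det M = (cmod \<kappa>)\<^sup>2"
    unfolding cmod_power2 by (simp add: M_def det_2 power2_eq_square)
  have g: "power_contracting ((*v) M)"
  proof (rule power_contracting_matrix_2)
    show "complex_of_real (M $ 1 $ 1 + M $ 2 $ 2) = \<kappa> + cnj \<kappa>"
      by (simp add: M_def complex_eq_iff)
    show "complex_of_real (det M) = \<kappa> * cnj \<kappa>"
      by (simp only: detM complex_norm_square)
  qed (use \<kappa> in auto)
  have linh: "linear h"
    by (rule linearI) (simp_all add: h_def vec_eq_iff forall_2)
  have "h (\<kappa> * z) = M *v h z" for z
    by (simp add: h_def M_def vec_eq_iff forall_2 matrix_vector_mult_def sum_2)
  from pm_attractor_linear_image[OF f matrix_vector_mul_linear g linh this]
  have image: "pm_attractor ((*v) M) (h 1) = h ` A_complex \<kappa>" by (simp add: A)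
  have "Im \<kappa> \<noteq> 0" using \<kappa>(1) by (simp add: complex_is_Real_iff)
  then have "h 1 $ 1 * (M *v h 1) $ 2 - h 1 $ 2 * (M *v h 1) $ 1 \<noteq> 0"
    by (simp add: h_def M_def matrix_vector_mult_def sum_2)
  then obtain \<alpha> \<beta> where coords: "coordinates_for (h 1) (M *v h 1) \<alpha> \<beta>"
    using coordinates_exist by blast
  have "(2 powr (-1/4)) ^ 4 < cmod \<kappa> ^ 4"
    using \<kappa>(2) by (intro power_strict_mono) auto
  then have "1 / 2 < (det (matrix ((*v) M)))\<^sup>2"
    unfolding two_powr_minus_quarter by (simp add: detM)
  from interior_if_determinant_large[OF matrix_vector_mul_linear g coords this]
  obtain x where x: "x \<in> interior (h ` A_complex \<kappa>)" unfolding image by blast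
  have "open (h -` interior (h ` A_complex \<kappa>))"
    using linh by (intro open_vimage linear_continuous_on) (simp_all add: linear_conv_bounded_linear)
  moreover have "h -` interior (h ` A_complex \<kappa>) \<subseteq> A_complex \<kappa>"
  proof -
    have "inj h" by (rule injI) (simp add: h_def vec_eq_iff forall_2 complex_eq_iff)
    then show ?thesis using interior_subset[of "h ` A_complex \<kappa>"] by (auto dest: injD)
  qed
  moreover have "x = h (Complex (x $ 1) (x $ 2))" by (simp add: h_def vec_eq_iff forall_2)
  then have "Complex (x $ 1) (x $ 2) \<in> h -` interior (h ` A_complex \<kappa>)" using x by simp
  ultimately show ?thesis by (metis interiorI empty_iff)
qed

lemma matrix_vector_mult_entries_2:
  fixes a b c d p q :: real
  shows "(vector [vector [a, b], vector [c, d]] :: real^2^2) *v vector [p, q]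
    = vector [a * p + b * q, c * p + d * q]"
  by (simp add: vec_eq_iff forall_2 matrix_vector_mult_def sum_2)

section \<open>The real diagonal and Jordan families\<close>

lemma diagonal_powers:
  "((*v) (vector [vector [x, 0], vector [0, y]] :: real^2^2) ^^ n) (vector [1, 1]) = (vector [x ^ n, y ^ n] :: real^2)"
  by (induction n) (simp_all add: matrix_vector_mult_entries_2)

text \<open>
For a diagonal matrix and \<open>u = (1, 1)\<close>, the vector relation \<open>u = a M u + b M\<^sup>n u\<close> says that
both diagonal entries are roots of \<open>1 - a X - b X\<^sup>n\<close>.
\<close>

lemma interior_A_real_if_relation:
  assumes "x \<noteq> y" "\<bar>x\<bar> < 1" "\<bar>y\<bar> < 1" and n: "2 \<le> n" "b \<noteq> 0"
    and rel: "a * x + b * x ^ n = 1" "a * y + b * y ^ n = 1" and short: "\<bar>a\<bar> + \<bar>b\<bar> \<le> 2"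
  shows "interior (A_real x y) \<noteq> {}"
proof -
  define M :: "real^2^2" where "M = vector [vector [x, 0], vector [0, y]]"
  define u :: "real^2" where "u = vector [1, 1]"
  have contr: "power_contracting ((*v) M)"
    by (rule power_contracting_matrix_2[of M "complex_of_real x" "complex_of_real y"])
       (use assms in \<open>simp_all add: M_def det_2\<close>)
  have "u $ 1 * (M *v u) $ 2 - u $ 2 * (M *v u) $ 1 \<noteq> 0"
    using assms by (simp add: u_def M_def matrix_vector_mult_def sum_2)
  then obtain \<alpha> \<beta> where coords: "coordinates_for u (M *v u) \<alpha> \<beta>"
    using coordinates_exist by blast
  have "u = a *\<^sub>R (M *v u) + b *\<^sub>R ((*v) M ^^ n) u"
    unfolding u_def M_def diagonal_powers
    using rel by (simp add: vec_eq_iff forall_2 matrix_vector_mult_def sum_2)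
  from interior_if_trinomial_relation[OF matrix_vector_mul_linear contr coords n this short]
  show ?thesis by (simp add: A_real_def affine_attractor_eq M_def u_def)
qed

text \<open>
The length of the trinomial \<open>1 - a X + b X\<^sup>8\<close> with a double root at \<open>x\<close>, leaving out the constant
term. It decreases in \<open>x\<close> and falls below 2 just before 0.832; the exponent 8 gives the
smallest such threshold among all trinomials \<open>1 - a X + b X\<^sup>n\<close>.
\<close>

lemma trinomial_length:
  fixes x :: real
  assumes "0.832 < x"
  shows "8 / (7 * x) + 1 / (7 * x ^ 8) \<le> 2"
proof -
  have "8 / (7 * x) \<le> 8 / (7 * 0.832)" using assms by (intro divide_left_mono) auto
  moreover have "1 / (7 * x ^ 8) \<le> 1 / (7 * 0.832 ^ 8)"
    using assms by (intro divide_left_mono mult_left_mono power_mono mult_pos_pos) auto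
  moreover have "8 / (7 * 0.832) + 1 / (7 * 0.832 ^ 8) \<le> (2 :: real)"
    by (simp add: power_divide field_simps)
  ultimately show ?thesis by linarith
qed

text \<open>
Two distinct roots \<open>x < y\<close> determine the trinomial \<open>1 - a X + b X\<^sup>8\<close>. Its coefficients are
bounded by those of the trinomial with a double root at \<open>x\<close>, since the quotient
\<open>H = (y\<^sup>7 - x\<^sup>7) / (y - x)\<close> is at least its limit \<open>7 x\<^sup>6\<close> for \<open>y \<rightarrow> x\<close>.
\<close>

lemma interior_positive_real:
  fixes x y :: real
  assumes "0.832 < x" "x < y" "y < 1"
  shows "interior (A_real x y) \<noteq> {}"
proof -
  define H where "H = (\<Sum>i<7. y ^ (6 - i) * x ^ i)"
  define b where "b = 1 / (x * y * H)"
  define a where "a = 1 / x + b * x ^ 7"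
  have pos: "0 < x" "0 < y" using assms by auto
  have diff: "y ^ 7 - x ^ 7 = (y - x) * H"
    unfolding H_def by (simp add: eval_nat_numeral algebra_simps)
  have H7: "7 * x ^ 6 \<le> H"
  proof -
    have "x ^ 6 \<le> y ^ (6 - i) * x ^ i" if "i < 7" for i
    proof -
      have "x ^ (6 - i) * x ^ i \<le> y ^ (6 - i) * x ^ i"
        using assms pos by (intro mult_right_mono power_mono) auto
      then show ?thesis using that by (simp add: power_add[symmetric])
    qed
    then have "(\<Sum>i<(7::nat). x ^ 6) \<le> H" unfolding H_def by (intro sum_mono) auto
    then show ?thesis by simp
  qed
  then have Hpos: "0 < H" using pos by (smt (verit) zero_less_power)
  have bpos: "0 < b" using pos Hpos by (simp add: b_def)
  have b_le: "b \<le> 1 / (7 * x ^ 8)"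
  proof -
    have "7 * x ^ 8 = x * x * (7 * x ^ 6)" by (simp add: eval_nat_numeral)
    also have "\<dots> \<le> x * y * H"
      using assms pos Hpos H7 by (intro mult_mono) auto
    finally show ?thesis unfolding b_def using pos Hpos by (intro divide_left_mono mult_pos_pos) auto
  qed
  have "b * x ^ 7 \<le> 1 / (7 * x ^ 8) * x ^ 7"
    using b_le pos by (intro mult_right_mono) auto
  also have "\<dots> = 1 / (7 * x)" using pos by (simp add: eval_nat_numeral field_simps)
  finally have a_le: "a \<le> 8 / (7 * x)" unfolding a_def using pos by (simp add: field_simps)
  have apos: "0 < a" using pos bpos by (simp add: a_def add_pos_pos)
  have "b * (y ^ 7 - x ^ 7) = 1 / x - 1 / y"
    unfolding diff b_def using pos Hpos by (simp add: field_simps)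
  then have a_y: "a = 1 / y + b * y ^ 7" by (simp add: a_def algebra_simps)
  have "a * x + (- b) * x ^ 8 = 1" using pos
    unfolding a_def by (simp add: eval_nat_numeral field_simps)
  moreover have "a * y + (- b) * y ^ 8 = 1" using pos
    unfolding a_y by (simp add: eval_nat_numeral field_simps)
  moreover have "\<bar>a\<bar> + \<bar>- b\<bar> \<le> 2"
    using apos bpos a_le b_le trinomial_length[OF assms(1)] by linarith
  ultimately show ?thesis
    using assms bpos by (intro interior_A_real_if_relation[of x y 8 "- b" a]) auto
qed

text \<open>
The quadratic \<open>(1 + X/x) (1 - X/y)\<close> has length \<open>1/x - 1/y + 1/(x y)\<close> apart from its constant
term. For \<open>x \<le> y\<close> this is largest at \<open>y = x\<close>, where it equals \<open>1/x\<^sup>2 < 2\<close>.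
\<close>

lemma interior_mixed_real:
  fixes x y :: real
  assumes "2 powr (-1/2) < x" "x < y" "y < 1"
  shows "interior (A_real (- x) y) \<noteq> {}"
proof -
  have pos: "0 < x" "0 < y" using assms powr_ge_zero[of 2 "- 1 / 2 :: real"] by linarith+
  have "(2 powr (-1/2))\<^sup>2 < x\<^sup>2" using assms(1) by (intro power_strict_mono) auto
  then have x2: "1 < 2 * (x * x)" unfolding two_powr_minus_half by (simp add: power2_eq_square)
  define a where "a = 1 / y - 1 / x"
  define b where "b = 1 / (x * y)"
  have "a \<le> 0" using assms pos by (simp add: a_def frac_le)
  have "0 < b" using pos by (simp add: b_def)
  have "2 * x * (y - x) \<ge> y - x"
  proof -
    have "x * x \<le> 1 * x" using assms pos by (intro mult_right_mono) auto
    then have "1 \<le> 2 * x" using x2 by linarith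
    then show ?thesis using assms mult_right_mono[of 1 "2 * x" "y - x"] by simp
  qed
  then have "y - x + 1 \<le> 2 * (x * y)" using x2 by (simp add: algebra_simps)
  then have "\<bar>a\<bar> + \<bar>b\<bar> \<le> 2"
    using \<open>a \<le> 0\<close> \<open>0 < b\<close> pos by (simp add: a_def b_def field_simps)
  moreover have "a * (- x) + b * (- x)\<^sup>2 = 1" "a * y + b * y\<^sup>2 = 1"
    using pos by (simp_all add: a_def b_def field_simps power2_eq_square)
  ultimately show ?thesis
    using assms pos \<open>0 < b\<close> by (intro interior_A_real_if_relation[of "- x" y 2 b a]) auto
qed

lemma jordan_powers:
  "((*v) (vector [vector [x, 1], vector [0, x]] :: real^2^2) ^^ Suc n) (vector [0, 1])
     = (vector [of_nat (Suc n) * x ^ n, x ^ Suc n] :: real^2)"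
  by (induction n) (simp_all add: matrix_vector_mult_entries_2 algebra_simps)

text \<open>
For the Jordan block and \<open>u = (0, 1)\<close>, the relation \<open>u = a M u + b M\<^sup>8 u\<close> says that \<open>x\<close> is a double
root of \<open>1 - a X - b X\<^sup>8\<close>, which determines \<open>a\<close> and \<open>b\<close>.
\<close>

lemma interior_jordan:
  fixes x :: real
  assumes "0.832 < x" "x < 1"
  shows "interior (A_jordan x) \<noteq> {}"
proof -
  define M :: "real^2^2" where "M = vector [vector [x, 1], vector [0, x]]"
  define u :: "real^2" where "u = vector [0, 1]"
  define a where "a = 8 / (7 * x)"
  define b where "b = - 1 / (7 * x ^ 8)"
  have pos: "0 < x" using assms by auto
  have contr: "power_contracting ((*v) M)"
    by (rule power_contracting_matrix_2[of M "complex_of_real x" "complex_of_real x"])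
       (use assms in \<open>simp_all add: M_def det_2\<close>)
  have "u $ 1 * (M *v u) $ 2 - u $ 2 * (M *v u) $ 1 \<noteq> 0"
    by (simp add: u_def M_def matrix_vector_mult_def sum_2)
  then obtain \<alpha> \<beta> where coords: "coordinates_for u (M *v u) \<alpha> \<beta>"
    using coordinates_exist by blast
  have "u = a *\<^sub>R (M *v u) + b *\<^sub>R ((*v) M ^^ Suc 7) u"
    unfolding u_def M_def jordan_powers using pos
    by (simp add: vec_eq_iff forall_2 matrix_vector_mult_def sum_2 a_def b_def)
       (simp add: eval_nat_numeral field_simps)
  moreover have "\<bar>a\<bar> + \<bar>b\<bar> \<le> 2"
    using trinomial_length[OF assms(1)] pos by (simp add: a_def b_def)
  moreover have "b \<noteq> 0" using pos by (simp add: b_def)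
  ultimately have "interior (pm_attractor ((*v) M) u) \<noteq> {}"
    by (intro interior_if_trinomial_relation[OF matrix_vector_mul_linear contr coords, of "Suc 7"]) auto
  then show ?thesis by (simp add: A_jordan_def affine_attractor_eq M_def u_def)
qed

theorem theorem1p1:
  shows "(\<forall>(M::real^2^2) (u::real^2).
            nondegenerate M u \<longrightarrow>
            (\<forall>\<theta>::complex. is_eigenvalue M \<theta> \<longrightarrow> 2 powr (-1/4) < cmod \<theta> \<and> cmod \<theta> < 1) \<longrightarrow>
            interior (affine_attractor M u) \<noteq> {})
       \<and> (\<forall>lam \<mu> :: real. 0.832 < lam \<and> lam < \<mu> \<and> \<mu> < 1 \<longrightarrow> interior (A_real lam \<mu>) \<noteq> {})
       \<and> (\<forall>lam \<mu> :: real. 2 powr (-1/2) < lam \<and> lam < \<mu> \<and> \<mu> < 1 \<longrightarrow> interior (A_real (- lam) \<mu>) \<noteq> {})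
       \<and> (\<forall>\<nu>::real. 0.832 < \<nu> \<and> \<nu> < 1 \<longrightarrow> interior (A_jordan \<nu>) \<noteq> {})
       \<and> (\<forall>\<kappa>::complex. \<kappa> \<notin> \<real> \<and> 2 powr (-1/4) < cmod \<kappa> \<and> cmod \<kappa> < 1 \<longrightarrow>
            interior (A_complex \<kappa>) \<noteq> {})"
  using interior_nondegenerate interior_positive_real interior_mixed_real interior_jordan
    interior_complex
  by blast

end
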